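(* Let $L$ be a completely regular frame. The following are equivalent: (1) $L$ is an extremally disconnected $P$-frame. (2) $\mathrm{C}(L)=\mathrm{H}_{nf}(L)$. (3) $\mathrm{C}(L)$ and $\mathrm{C}(\mathfrak{B}(L))$ are isomorphic as Riesz spaces. (4) $\mathrm{C}(L)$ is universally complete.
   Context: Frames: $a^\ast=\bigvee\{b\mid a\wedge b=0\}$ is the pseudocomplement in a frame $L$; $a$ is complemented if $a\vee a^\ast=1$. Write $b\prec a$ if $b^\ast\vee a=1$, and $b\prec\!\!\prec a$ if there are $c_r\in L$ ($r\in\mathbb{Q}\cap[0,1]$) with $b\le c_0$, $c_1\le a$, $c_r\prec c_s$ for $r<s$. $L$ is completely regular if $a=\bigvee\{b\mid b\prec\!\!\prec a\}$ for all $a$; extremally disconnected if $a^\ast\vee a^{\ast\ast}=1$ for all $a$. $\mathfrak{B}(L)=\{a\in L\mid a=a^{\ast\ast}\}$ is the Booleanization, a complete Boolean algebra (hence a frame) with meets as in $L$ and joins $(\bigvee^L A)^{\ast\ast}$. Consider generators $(p,-)$ and $(-,p)$, $p\in\mathbb{Q}$, and relations (r1) $(p,-)\wedge(-,q)=0$ if $p\ge q$; (r2) $(p,-)\vee(-,q)=1$ if $p<q$; (r3) $(p,-)=\bigvee_{q>p}(q,-)$; (r4) $(-,p)=\bigvee_{q<p}(-,q)$; (r5) $\bigvee_p(p,-)=1$; (r6) $\bigvee_p(-,p)=1$. $\mathfrak{L}(\mathbb{R})$ is the frame presented by (r1)–(r6); $\mathfrak{L}(\overline{\mathbb{IR}})$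 is the frame presented by (r1), (r3), (r4) only. $\mathrm{C}(L)$ is the set of frame homomorphisms $\mathfrak{L}(\mathbb{R})\to L$, and $\overline{\mathrm{IC}}(L)$ the set of frame homomorphisms $\mathfrak{L}(\overline{\mathbb{IR}})\to L$; $\mathrm{C}(L)$ is identified with the set of those $f\in\overline{\mathrm{IC}}(L)$ turning (r2), (r5), (r6) into identities in $L$. $\mathrm{C}(L)$ is ordered by $f\le g$ iff $f(p,-)\le g(p,-)$ for all $p\in\mathbb{Q}$, and is an Archimedean Riesz space with $(f\vee g)(p,-)=f(p,-)\vee g(p,-)$, $(f\wedge g)(p,-)=f(p,-)\wedge g(p,-)$, $(f+g)(p,-)=\bigvee_{r\in\mathbb{Q}}f(r,-)\wedge g(p-r,-)$, $(f+g)(-,q)=\bigvee_{s\in\mathbb{Q}}f(-,s)\wedge g(-,q-s)$, $(-f)(p,-)=f(-,-p)$, $(-f)(-,q)=f(-q,-)$, and for $\lambda>0$ $(\lambda f)(p,-)=\bigvee\{f(r,-)\mid r\in\mathbb{Q},\lambda r>p\}$, $(\lambda f)(-,q)=\bigvee\{f(-,s)\mid s\in\mathbb{Q},\lambda s<q\}$. An element $a\in L$ is a cozero if $a=f(-,0)\vee f(0,-)$ for some $f\in\mathrm{C}(L)$. $L$ is a $P$-frame if every cozero element is complemented. $f\in\overline{\mathrm{IC}}(L)$ is Hausdorff continuous if $f(p,-)^\ast\le f(-,q)$ and $f(-,q)^\ast\le f(p,-)$ for all $p<q$ in $\mathbb{Q}$; it is nearly finite if moreover $(\bigvee_p f(p,-))^{\ast\ast}=1=(\bigvee_q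 f(-,q))^{\ast\ast}$. $\mathrm{H}_{nf}(L)\subseteq\overline{\mathrm{IC}}(L)$ is the set of nearly finite Hausdorff continuous functions; it contains $\mathrm{C}(L)$. A Riesz space is universally complete if it is Dedekind complete (nonempty subsets bounded above have suprema) and laterally complete (every nonempty set of pairwise disjoint positive elements has a supremum). *)

theory Defs
  imports Complex_Main
begin

section \<open>Frames\<close>

text \<open>The class \<^class>\<open>complete_distrib_lattice\<close> demands complete distributivity and is therefore
  much stronger than the frame law.\<close>

class frame = complete_lattice +
  assumes inf_Sup_frame: "inf a (Sup B) = (SUP b\<in>B. inf a b)"

definition frame_hom :: "('a::frame \<Rightarrow> 'b::frame) \<Rightarrow> bool" where
  "frame_hom f \<longleftrightarrow> f top = top \<and> (\<forall>a b. f (inf a b) = inf (f a) (f b))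
     \<and> (\<forall>A. f (Sup A) = Sup (f ` A))"

definition pcomp :: "'a::frame \<Rightarrow> 'a" where
  "pcomp a = Sup {b. inf a b = bot}"

definition complemented :: "'a::frame \<Rightarrow> bool" where
  "complemented a \<longleftrightarrow> sup a (pcomp a) = top"

definition rather_below :: "'a::frame \<Rightarrow> 'a \<Rightarrow> bool" (infix "\<prec>" 50) where
  "b \<prec> a \<longleftrightarrow> sup (pcomp b) a = top"

definition completely_below :: "'a::frame \<Rightarrow> 'a \<Rightarrow> bool" (infix "\<prec>\<prec>" 50) where
  "b \<prec>\<prec> a \<longleftrightarrow> (\<exists>c :: rat \<Rightarrow> 'a. b \<le> c 0 \<and> c 1 \<le> a
     \<and> (\<forall>r\<in>{0..1}. \<forall>s\<in>{0..1}. r < s \<longrightarrow> c r \<prec> c s))"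

definition completely_regular :: "'a::frame itself \<Rightarrow> bool" where
  "completely_regular _ \<longleftrightarrow> (\<forall>a::'a. a = Sup {b. b \<prec>\<prec> a})"

definition extremally_disconnected :: "'a::frame itself \<Rightarrow> bool" where
  "extremally_disconnected _ \<longleftrightarrow> (\<forall>a::'a. sup (pcomp a) (pcomp (pcomp a)) = top)"

lemma inf_SUP_frame: "inf a (SUP i\<in>I. f i) = (SUP i\<in>I. inf a (f i))" for a :: "'a::frame"
  by (simp add: inf_Sup_frame image_image)

lemma SUP_inf_frame: "inf (SUP i\<in>I. f i) a = (SUP i\<in>I. inf (f i) a)" for a :: "'a::frame"
  using inf_SUP_frame[of a f I] by (simp add: inf_commute)

lemma le_pcomp_iff: "b \<le> pcomp a \<longleftrightarrow> inf a b = bot" for a :: "'a::frame"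
proof
  assume "b \<le> pcomp a"
  then have "inf a b \<le> inf a (pcomp a)" by (simp add: le_infI2)
  also have "\<dots> = (SUP b\<in>{b. inf a b = bot}. inf a b)"
    unfolding pcomp_def by (rule inf_Sup_frame)
  also have "\<dots> \<le> bot" by (rule SUP_least) simp
  finally show "inf a b = bot" by (simp add: bot_unique)
qed (simp add: pcomp_def Sup_upper)

lemma pcomp_antimono: "a \<le> b \<Longrightarrow> pcomp b \<le> pcomp a" for a :: "'a::frame"
  by (metis bot_unique inf_mono le_pcomp_iff order_refl)

lemma le_pcomp_pcomp: "a \<le> pcomp (pcomp a)" for a :: "'a::frame"
  by (metis inf_commute le_pcomp_iff order_refl)

lemma pcomp_pcomp_pcomp: "pcomp (pcomp (pcomp a)) = pcomp a" for a :: "'a::frame"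
  by (simp add: antisym le_pcomp_pcomp pcomp_antimono)

lemma pcomp_pcomp_mono: "a \<le> b \<Longrightarrow> pcomp (pcomp a) \<le> pcomp (pcomp b)" for a :: "'a::frame"
  by (simp add: pcomp_antimono)

lemma inf_pcomp_pcomp_eq_bot: "inf a b = bot \<Longrightarrow> inf (pcomp (pcomp a)) b = bot" for a :: "'a::frame"
  by (metis inf_commute le_pcomp_iff pcomp_pcomp_pcomp)

lemma pcomp_pcomp_bot: "pcomp (pcomp bot) = (bot :: 'a::frame)"
  using inf_pcomp_pcomp_eq_bot[of bot "pcomp (pcomp bot) :: 'a"] by simp


section \<open>The Booleanization\<close>

typedef (overloaded) 'a booleanization = "{a::'a::frame. pcomp (pcomp a) = a}"
  by (rule exI[of _ "pcomp bot"]) (simp add: pcomp_pcomp_pcomp)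

setup_lifting type_definition_booleanization

instantiation booleanization :: (frame) frame
begin

lift_definition less_eq_booleanization :: "'a booleanization \<Rightarrow> 'a booleanization \<Rightarrow> bool" is "(\<le>)" .

lift_definition less_booleanization :: "'a booleanization \<Rightarrow> 'a booleanization \<Rightarrow> bool" is "(<)" .

lift_definition inf_booleanization :: "'a booleanization \<Rightarrow> 'a booleanization \<Rightarrow> 'a booleanization"
  is inf
proof -
  fix a b :: 'a
  assume "pcomp (pcomp a) = a" "pcomp (pcomp b) = b"
  then show "pcomp (pcomp (inf a b)) = inf a b"
    using pcomp_pcomp_mono[of "inf a b" a] pcomp_pcomp_mono[of "inf a b" b]
    by (intro antisym le_pcomp_pcomp) simp_all
qed

lift_definition sup_booleanization :: "'a booleanization \<Rightarrow> 'a booleanization \<Rightarrow> 'a booleanization"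
  is "\<lambda>a b. pcomp (pcomp (sup a b))"
  by (simp add: pcomp_pcomp_pcomp)

lift_definition Inf_booleanization :: "'a booleanization set \<Rightarrow> 'a booleanization" is Inf
proof -
  fix A :: "'a set"
  assume *: "\<And>a. a \<in> A \<Longrightarrow> pcomp (pcomp a) = a"
  have "pcomp (pcomp (Inf A)) \<le> a" if "a \<in> A" for a
    using that * pcomp_pcomp_mono[OF Inf_lower[OF that]] by simp
  then show "pcomp (pcomp (Inf A)) = Inf A"
    by (intro antisym Inf_greatest le_pcomp_pcomp) auto
qed

lift_definition Sup_booleanization :: "'a booleanization set \<Rightarrow> 'a booleanization"
  is "\<lambda>A. pcomp (pcomp (Sup A))"
  by (simp add: pcomp_pcomp_pcomp)

lift_definition bot_booleanization :: "'a booleanization" is bot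
  by (rule pcomp_pcomp_bot)

lift_definition top_booleanization :: "'a booleanization" is top
  by (rule top_le, rule le_pcomp_pcomp)

instance
proof
  fix x y z :: "'a booleanization" and A :: "'a booleanization set"
  show "x < y \<longleftrightarrow> x \<le> y \<and> \<not> y \<le> x" by transfer (rule less_le_not_le)
  show "x \<le> x" by transfer simp
  show "x \<le> y \<Longrightarrow> y \<le> z \<Longrightarrow> x \<le> z" by transfer (rule order_trans)
  show "x \<le> y \<Longrightarrow> y \<le> x \<Longrightarrow> x = y" by transfer (rule antisym)
  show "inf x y \<le> x" "inf x y \<le> y" by (transfer, simp)+
  show "x \<le> y \<Longrightarrow> x \<le> z \<Longrightarrow> x \<le> inf y z" by transfer simp
  show "x \<le> sup x y" by transfer (rule order_trans[OF sup_ge1 le_pcomp_pcomp])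
  show "y \<le> sup x y" by transfer (rule order_trans[OF sup_ge2 le_pcomp_pcomp])
  show "y \<le> x \<Longrightarrow> z \<le> x \<Longrightarrow> sup y z \<le> x"
    by transfer (erule subst, rule pcomp_pcomp_mono, simp)
  show "x \<in> A \<Longrightarrow> Inf A \<le> x" by transfer (rule Inf_lower)
  show "(\<And>y. y \<in> A \<Longrightarrow> x \<le> y) \<Longrightarrow> x \<le> Inf A"
    by transfer (rule Inf_greatest, blast)
  show "x \<in> A \<Longrightarrow> x \<le> Sup A"
    by transfer (rule order_trans[OF Sup_upper le_pcomp_pcomp])
  show "(\<And>y. y \<in> A \<Longrightarrow> y \<le> x) \<Longrightarrow> Sup A \<le> x"
    by transfer (erule subst, rule pcomp_pcomp_mono, rule Sup_least, blast)
  show "Inf {} = (top :: 'a booleanization)" by transfer simp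
  show "Sup {} = (bot :: 'a booleanization)"
    by transfer (simp add: pcomp_pcomp_bot)
  show "inf x (Sup A) = (SUP b\<in>A. inf x b)"
  proof transfer
    fix x :: 'a and A :: "'a set"
    assume x: "pcomp (pcomp x) = x"
    let ?S = "SUP b\<in>A. inf x b"
    have S: "?S = inf x (Sup A)" by (simp add: inf_Sup_frame)
    show "inf x (pcomp (pcomp (Sup A))) = pcomp (pcomp ?S)"
    proof (rule antisym)
      have "inf (Sup A) (inf x (pcomp ?S)) = bot"
        using le_pcomp_iff[of "pcomp ?S" ?S] S by (simp add: ac_simps)
      then have "inf (pcomp (pcomp (Sup A))) (inf x (pcomp ?S)) = bot"
        by (rule inf_pcomp_pcomp_eq_bot)
      then show "inf x (pcomp (pcomp (Sup A))) \<le> pcomp (pcomp ?S)"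
        by (simp add: le_pcomp_iff ac_simps)
      show "pcomp (pcomp ?S) \<le> inf x (pcomp (pcomp (Sup A)))"
        using pcomp_pcomp_mono[of ?S x] pcomp_pcomp_mono[of ?S "Sup A"] x S by simp
    qed
  qed
qed

end


section \<open>Frames presented by generators and relations\<close>

text \<open>A pair \<open>(F, \<G>)\<close> in \<open>relations\<close> stands for the relation that equates the meet of the
  finite set of generators \<open>F\<close> with the join, over \<open>G \<in> \<G>\<close>, of the meets of the finite
  sets \<open>G\<close>.\<close>

class frame_presentation =
  fixes relations :: "('a set \<times> 'a set set) set"
  assumes relations_finite: "(F, \<G>) \<in> relations \<Longrightarrow> finite F \<and> (\<forall>G\<in>\<G>. finite G)"

text \<open>The free frame consists of the families of finite sets of generators (finite formal meets)
  closed under passing to larger finite sets.  The presented frame is its quotient by the congruence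
  that the relations generate, realised as usual as the set of saturated elements; that it has the
  universal property is proved below.\<close>

definition saturated :: "'g::frame_presentation set set \<Rightarrow> bool" where
  "saturated U \<longleftrightarrow> (\<forall>F\<in>U. finite F) \<and> (\<forall>F\<in>U. \<forall>G. finite G \<and> F \<subseteq> G \<longrightarrow> G \<in> U)
     \<and> (\<forall>(F, \<G>)\<in>relations. \<forall>H. finite H \<longrightarrow> (F \<union> H \<in> U \<longleftrightarrow> (\<forall>G\<in>\<G>. G \<union> H \<in> U)))"

lemma saturatedI:
  assumes "\<And>F. F \<in> U \<Longrightarrow> finite F"
    and "\<And>F G. F \<in> U \<Longrightarrow> finite G \<Longrightarrow> F \<subseteq> G \<Longrightarrow> G \<in> U"
    and "\<And>F \<G> H. (F, \<G>) \<in> relations \<Longrightarrow> finite F \<Longrightarrow> (\<And>G. G \<in> \<G> \<Longrightarrow> finite G) \<Longrightarrow> finite H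
           \<Longrightarrow> F \<union> H \<in> U \<longleftrightarrow> (\<forall>G\<in>\<G>. G \<union> H \<in> U)"
  shows "saturated U"
  unfolding saturated_def
proof (intro conjI ballI allI impI, goal_cases)
  case (3 r)
  then show ?case using assms(3) relations_finite by (cases r) (simp, blast)
qed (use assms(1,2) in blast)+

lemma saturated_finite: "F \<in> U \<Longrightarrow> finite F"
  and saturated_mono: "F \<in> U \<Longrightarrow> finite G \<Longrightarrow> F \<subseteq> G \<Longrightarrow> G \<in> U"
  and saturated_rel: "(F, \<G>) \<in> relations \<Longrightarrow> finite H
        \<Longrightarrow> F \<union> H \<in> U \<longleftrightarrow> (\<forall>G\<in>\<G>. G \<union> H \<in> U)"
  if U: "saturated U"
proof -
  note sat = U[unfolded saturated_def]
  show "F \<in> U \<Longrightarrow> finite F"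
    by (rule sat[THEN conjunct1, rule_format])
  show "F \<in> U \<Longrightarrow> finite G \<Longrightarrow> F \<subseteq> G \<Longrightarrow> G \<in> U"
    by (rule sat[THEN conjunct2, THEN conjunct1, rule_format, OF _ conjI])
  show "F \<union> H \<in> U \<longleftrightarrow> (\<forall>G\<in>\<G>. G \<union> H \<in> U)" if "(F, \<G>) \<in> relations" "finite H"
    using bspec[OF sat[THEN conjunct2, THEN conjunct2] that(1), unfolded prod.case,
        THEN spec, THEN mp, OF that(2)] .
qed

lemma saturated_Inter:
  assumes "\<And>U. U \<in> \<U> \<Longrightarrow> saturated U"
  shows "saturated ({F. finite F} \<inter> \<Inter>\<U>)"
proof (rule saturatedI, goal_cases)
  case (2 F G)
  have "G \<in> U" if "U \<in> \<U>" for U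
    by (rule saturated_mono[OF assms[OF that] _ 2(2,3)]) (use 2(1) that in blast)
  then show ?case using 2(2) by blast
next
  case (3 F \<G> H)
  have *: "F \<union> H \<in> U \<longleftrightarrow> (\<forall>G\<in>\<G>. G \<union> H \<in> U)" if "U \<in> \<U>" for U
    by (rule saturated_rel[OF assms[OF that] 3(1,4)])
  have fin: "finite (F \<union> H)" "\<And>G. G \<in> \<G> \<Longrightarrow> finite (G \<union> H)" using 3 by simp_all
  have "F \<union> H \<in> {F. finite F} \<inter> \<Inter>\<U> \<longleftrightarrow> (\<forall>U\<in>\<U>. F \<union> H \<in> U)" using fin by simp
  also have "\<dots> \<longleftrightarrow> (\<forall>U\<in>\<U>. \<forall>G\<in>\<G>. G \<union> H \<in> U)" using * by simp
  also have "\<dots> \<longleftrightarrow> (\<forall>G\<in>\<G>. \<forall>U\<in>\<U>. G \<union> H \<in> U)" by blast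
  also have "\<dots> \<longleftrightarrow> (\<forall>G\<in>\<G>. G \<union> H \<in> {F. finite F} \<inter> \<Inter>\<U>)" using fin by simp
  finally show ?case .
qed simp

lemma saturated_translate:
  assumes "saturated U" "\<And>K. K \<in> \<K> \<Longrightarrow> finite K"
  shows "saturated {F. finite F \<and> (\<forall>K\<in>\<K>. F \<union> K \<in> U)}"
proof (rule saturatedI, goal_cases)
  case (2 F G)
  have "G \<union> K \<in> U" if "K \<in> \<K>" for K
  proof (rule saturated_mono[OF assms(1)])
    show "F \<union> K \<in> U" using 2 that by simp
    show "finite (G \<union> K)" using 2 assms(2)[OF that] by simp
    show "F \<union> K \<subseteq> G \<union> K" using 2 by blast
  qed
  then show ?case using 2 by simp
next
  case (3 F \<G> H)
  have "F \<union> (H \<union> K) \<in> U \<longleftrightarrow> (\<forall>G\<in>\<G>. G \<union> (H \<union> K) \<in> U)" if "K \<in> \<K>" for K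
    using saturated_rel[OF assms(1) 3(1)] 3(4) assms(2)[OF that] by simp
  then have *: "(F \<union> H) \<union> K \<in> U \<longleftrightarrow> (\<forall>G\<in>\<G>. (G \<union> H) \<union> K \<in> U)" if "K \<in> \<K>" for K
    using that by (simp only: Un_assoc)
  have fin: "finite (F \<union> H)" "\<And>G. G \<in> \<G> \<Longrightarrow> finite (G \<union> H)" using 3 by simp_all
  have "F \<union> H \<in> {F. finite F \<and> (\<forall>K\<in>\<K>. F \<union> K \<in> U)}
      \<longleftrightarrow> (\<forall>K\<in>\<K>. (F \<union> H) \<union> K \<in> U)" using fin(1) by simp
  also have "\<dots> \<longleftrightarrow> (\<forall>K\<in>\<K>. \<forall>G\<in>\<G>. (G \<union> H) \<union> K \<in> U)"
    using * by (rule ball_cong[OF refl])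
  also have "\<dots> \<longleftrightarrow> (\<forall>G\<in>\<G>. \<forall>K\<in>\<K>. (G \<union> H) \<union> K \<in> U)" by blast
  also have "\<dots> \<longleftrightarrow> (\<forall>G\<in>\<G>. G \<union> H \<in> {F. finite F \<and> (\<forall>K\<in>\<K>. F \<union> K \<in> U)})"
    using fin(2) by simp
  finally show ?case .
qed simp

typedef (overloaded) 'g presented = "{U :: 'g::frame_presentation set set. saturated U}"
  using saturated_Inter[of "{}"] by blast

setup_lifting type_definition_presented

instantiation presented :: (frame_presentation) frame
begin

lift_definition less_eq_presented :: "'a presented \<Rightarrow> 'a presented \<Rightarrow> bool" is "(\<subseteq>)" .

lift_definition less_presented :: "'a presented \<Rightarrow> 'a presented \<Rightarrow> bool" is "(\<subset>)" .

lift_definition Inf_presented :: "'a presented set \<Rightarrow> 'a presented"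
  is "\<lambda>\<U>. {F. finite F} \<inter> \<Inter>\<U>"
  by (rule saturated_Inter)

definition Sup_presented :: "'a presented set \<Rightarrow> 'a presented" where
  "Sup_presented A = Inf {b. \<forall>a\<in>A. a \<le> b}"

definition inf_presented :: "'a presented \<Rightarrow> 'a presented \<Rightarrow> 'a presented" where
  "inf_presented a b = Inf {a, b}"

definition sup_presented :: "'a presented \<Rightarrow> 'a presented \<Rightarrow> 'a presented" where
  "sup_presented a b = Sup {a, b}"

definition top_presented :: "'a presented" where
  "top_presented = Inf {}"

definition bot_presented :: "'a presented" where
  "bot_presented = Sup {}"

instance
proof
  fix x y z :: "'a presented" and A :: "'a presented set"
  have Inf_lower': "x \<in> A \<Longrightarrow> Inf A \<le> x" for x :: "'a presented" and A
    by transfer auto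
  have Inf_greatest': "(\<And>y. y \<in> A \<Longrightarrow> x \<le> y) \<Longrightarrow> x \<le> Inf A" for x :: "'a presented" and A
    by transfer (auto dest: saturated_finite)
  have trans': "x \<le> y \<Longrightarrow> y \<le> z \<Longrightarrow> x \<le> z" for x y z :: "'a presented"
    by transfer auto
  have Sup_upper': "x \<in> A \<Longrightarrow> x \<le> Sup A" for x :: "'a presented" and A
    unfolding Sup_presented_def by (rule Inf_greatest') auto
  have Sup_least': "(\<And>y. y \<in> A \<Longrightarrow> y \<le> x) \<Longrightarrow> Sup A \<le> x" for x :: "'a presented" and A
    unfolding Sup_presented_def by (rule Inf_lower') auto
  have antisym': "x \<le> y \<Longrightarrow> y \<le> x \<Longrightarrow> x = y" for x y :: "'a presented"
    by transfer auto
  have inf_lower': "inf x y \<le> x" "inf x y \<le> y" for x y :: "'a presented"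
    unfolding inf_presented_def by (auto intro: Inf_lower')
  have inf_greatest': "x \<le> y \<Longrightarrow> x \<le> z \<Longrightarrow> x \<le> inf y z" for x y z :: "'a presented"
    unfolding inf_presented_def by (rule Inf_greatest') auto
  show "x < y \<longleftrightarrow> x \<le> y \<and> \<not> y \<le> x" by transfer auto
  show "x \<le> x" by transfer auto
  show "x \<le> y \<Longrightarrow> y \<le> z \<Longrightarrow> x \<le> z" by (rule trans')
  show "x \<le> y \<Longrightarrow> y \<le> x \<Longrightarrow> x = y" by (rule antisym')
  show "inf x y \<le> x" "inf x y \<le> y" by (fact inf_lower')+
  show "x \<le> y \<Longrightarrow> x \<le> z \<Longrightarrow> x \<le> inf y z" by (rule inf_greatest')
  show "x \<le> sup x y" "y \<le> sup x y"
    unfolding sup_presented_def by (auto intro: Sup_upper')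
  show "y \<le> x \<Longrightarrow> z \<le> x \<Longrightarrow> sup y z \<le> x"
    unfolding sup_presented_def by (rule Sup_least') auto
  show "x \<in> A \<Longrightarrow> Inf A \<le> x" by (rule Inf_lower')
  show "(\<And>y. y \<in> A \<Longrightarrow> x \<le> y) \<Longrightarrow> x \<le> Inf A" by (rule Inf_greatest')
  show "x \<in> A \<Longrightarrow> x \<le> Sup A" by (rule Sup_upper')
  show "(\<And>y. y \<in> A \<Longrightarrow> y \<le> x) \<Longrightarrow> Sup A \<le> x" by (rule Sup_least')
  show "Inf {} = (top :: 'a presented)" "Sup {} = (bot :: 'a presented)"
    by (simp_all add: top_presented_def bot_presented_def)
  show "inf x (Sup A) = (SUP b\<in>A. inf x b)"
  proof (rule antisym')
    have "inf x b \<le> inf x (Sup A)" if "b \<in> A" for b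
      by (rule inf_greatest'[OF inf_lower'(1) trans'[OF inf_lower'(2) Sup_upper'[OF that]]])
    then show "(SUP b\<in>A. inf x b) \<le> inf x (Sup A)"
      by (intro Sup_least') blast
    have imp: "\<exists>v. \<forall>b. inf x b \<le> w \<longleftrightarrow> b \<le> v" for w :: "'a presented"
    proof -
      let ?x = "Rep_presented x" and ?w = "Rep_presented w"
      let ?V = "{F. finite F \<and> (\<forall>K\<in>?x. F \<union> K \<in> ?w)}"
      have sat: "saturated (Rep_presented u)" for u :: "'a presented"
        using Rep_presented by blast
      have V: "saturated ?V"
        by (rule saturated_translate[OF sat saturated_finite[OF sat]])
      have inf: "Rep_presented (inf x b) = ?x \<inter> Rep_presented b" for b
        unfolding inf_presented_def Inf_presented.rep_eq using saturated_finite[OF sat] by auto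
      have "?x \<inter> Rep_presented b \<subseteq> ?w \<longleftrightarrow> Rep_presented b \<subseteq> ?V" for b
      proof
        assume *: "?x \<inter> Rep_presented b \<subseteq> ?w"
        have "F \<union> K \<in> ?w" if FK: "F \<in> Rep_presented b" "K \<in> ?x" for F K
        proof -
          have "finite (F \<union> K)" using saturated_finite[OF sat] FK by blast
          then have "F \<union> K \<in> ?x" "F \<union> K \<in> Rep_presented b"
            using saturated_mono[OF sat FK(2)] saturated_mono[OF sat FK(1)] by auto
          then show ?thesis using * by blast
        qed
        then show "Rep_presented b \<subseteq> ?V" using saturated_finite[OF sat] by blast
      next
        assume *: "Rep_presented b \<subseteq> ?V"
        have "F \<in> ?w" if F: "F \<in> ?x" "F \<in> Rep_presented b" for F
        proof -
          have "F \<union> F \<in> ?w" using * F by blast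
          then show ?thesis by simp
        qed
        then show "?x \<inter> Rep_presented b \<subseteq> ?w" by blast
      qed
      then have "inf x b \<le> w \<longleftrightarrow> b \<le> Abs_presented ?V" for b
        unfolding less_eq_presented.rep_eq inf by (simp add: Abs_presented_inverse V)
      then show ?thesis by blast
    qed
    obtain v where v: "\<And>b. inf x b \<le> (SUP b\<in>A. inf x b) \<longleftrightarrow> b \<le> v"
      using imp[of "SUP b\<in>A. inf x b"] by blast
    have "b \<le> v" if "b \<in> A" for b
      unfolding v[symmetric] by (rule Sup_upper') (use that in blast)
    then have "Sup A \<le> v" by (rule Sup_least')
    then show "inf x (Sup A) \<le> (SUP b\<in>A. inf x b)" by (simp add: v)
  qed
qed

end

definition formal_meet :: "'g::frame_presentation set \<Rightarrow> 'g presented" where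
  "formal_meet F = Inf {U. F \<in> Rep_presented U}"

definition generator :: "'g::frame_presentation \<Rightarrow> 'g presented" where
  "generator g = formal_meet {g}"

definition satisfies_relations :: "('g::frame_presentation \<Rightarrow> 'a::frame) \<Rightarrow> bool" where
  "satisfies_relations v \<longleftrightarrow> (\<forall>(F, \<G>)\<in>relations. Inf (v ` F) = (SUP G\<in>\<G>. Inf (v ` G)))"

lemma formal_meet_le_iff: "finite F \<Longrightarrow> formal_meet F \<le> U \<longleftrightarrow> F \<in> Rep_presented U"
proof
  assume F: "finite F"
  have "F \<in> Rep_presented (formal_meet F)"
    unfolding formal_meet_def using F by transfer auto
  then show "formal_meet F \<le> U \<Longrightarrow> F \<in> Rep_presented U"
    unfolding less_eq_presented.rep_eq by blast
qed (simp add: formal_meet_def Inf_lower)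

lemma Rep_presented_mono: "F \<in> Rep_presented U \<Longrightarrow> finite G \<Longrightarrow> F \<subseteq> G \<Longrightarrow> G \<in> Rep_presented U"
  by transfer (rule saturated_mono)

lemma Rep_presented_finite: "F \<in> Rep_presented U \<Longrightarrow> finite F"
  by transfer (rule saturated_finite)

lemma Rep_presented_inf: "Rep_presented (inf U V) = Rep_presented U \<inter> Rep_presented V"
  unfolding inf_presented_def by transfer (auto dest: saturated_finite)

lemma Rep_presented_top: "Rep_presented top = {F. finite F}"
  unfolding top_presented_def by transfer simp

lemma formal_meet_Un:
  assumes "finite F" "finite G"
  shows "formal_meet (F \<union> G) = inf (formal_meet F) (formal_meet G)"
proof (rule antisym)
  show "formal_meet (F \<union> G) \<le> inf (formal_meet F) (formal_meet G)"
    using assms formal_meet_le_iff[of F "formal_meet F"] formal_meet_le_iff[of G "formal_meet G"]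
    by (auto simp: formal_meet_le_iff intro: Rep_presented_mono)
  let ?W = "Rep_presented (formal_meet (F \<union> G))"
  have W: "saturated ?W" using Rep_presented by auto
  have FGW: "F \<union> G \<in> ?W" using assms formal_meet_le_iff[of "F \<union> G" "formal_meet (F \<union> G)"] by simp
  have leI: "Rep_presented (formal_meet F') \<subseteq> V" if "saturated V" "F' \<in> V" for F' :: "'a set" and V
  proof -
    have "formal_meet F' \<le> Abs_presented V"
      using that saturated_finite[OF that] by (simp add: formal_meet_le_iff Abs_presented_inverse)
    then show ?thesis using that by (simp add: less_eq_presented.rep_eq Abs_presented_inverse)
  qed
  have 1: "Rep_presented (formal_meet F) \<subseteq> {K. finite K \<and> (\<forall>M\<in>{G}. K \<union> M \<in> ?W)}"
    by (rule leI[OF saturated_translate[OF W]]) (use assms FGW in auto)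
  have 2: "Rep_presented (formal_meet G) \<subseteq> {M. finite M \<and> (\<forall>K\<in>{K}. M \<union> K \<in> ?W)}"
    if "K \<in> Rep_presented (formal_meet F)" for K
    by (rule leI[OF saturated_translate[OF W]]) (use assms 1 that in \<open>auto simp: Un_commute\<close>)
  show "inf (formal_meet F) (formal_meet G) \<le> formal_meet (F \<union> G)"
    unfolding less_eq_presented.rep_eq Rep_presented_inf
    using 2 by fastforce
qed

lemma formal_meet_eq: "finite F \<Longrightarrow> formal_meet F = Inf (generator ` F)"
proof (induction F rule: finite_induct)
  case empty
  have "{} \<in> Rep_presented U \<Longrightarrow> U = top" for U :: "'a presented"
    by (metis Rep_presented_inject Rep_presented_mono Rep_presented_finite Rep_presented_top
        empty_subsetI mem_Collect_eq subsetI subset_antisym)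
  then show ?case by (simp add: formal_meet_le_iff[symmetric] top_unique)
next
  case (insert g F)
  then show ?case using formal_meet_Un[of "{g}" F] by (simp add: generator_def)
qed

lemma presented_eq_SUP: "U = (SUP F\<in>Rep_presented U. Inf (generator ` F))"
proof -
  have "U = (SUP F\<in>Rep_presented U. formal_meet F)"
  proof (rule antisym)
    let ?V = "SUP F\<in>Rep_presented U. formal_meet F"
    have "F \<in> Rep_presented ?V" if "F \<in> Rep_presented U" for F
      using formal_meet_le_iff[OF Rep_presented_finite[OF that], of ?V]
        SUP_upper[OF that, of formal_meet] by blast
    then show "U \<le> ?V" by (auto simp: less_eq_presented.rep_eq)
    show "?V \<le> U" by (rule SUP_least) (simp add: formal_meet_le_iff Rep_presented_finite)
  qed
  then show ?thesis by (simp add: formal_meet_eq Rep_presented_finite cong: SUP_cong)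
qed

theorem satisfies_relations_generator: "satisfies_relations generator"
proof -
  have "Inf (generator ` F) = (SUP G\<in>\<G>. Inf (generator ` G))"
    if r: "(F, \<G>) \<in> relations" for F :: "'a set" and \<G>
  proof -
    have fin: "finite F" "\<And>G. G \<in> \<G> \<Longrightarrow> finite G" using relations_finite[OF r] by auto
    have "formal_meet F \<le> U \<longleftrightarrow> (SUP G\<in>\<G>. formal_meet G) \<le> U" for U :: "'a presented"
    proof -
      have "F \<in> Rep_presented U \<longleftrightarrow> (\<forall>G\<in>\<G>. G \<in> Rep_presented U)"
        using saturated_rel[of "Rep_presented U", OF _ r, of "{}"] Rep_presented[of U] by simp
      then show ?thesis using fin by (simp add: formal_meet_le_iff SUP_le_iff)
    qed
    then have "formal_meet F = (SUP G\<in>\<G>. formal_meet G)" by (metis antisym order_refl)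
    then show ?thesis using fin by (simp add: formal_meet_eq cong: SUP_cong)
  qed
  then show ?thesis by (auto simp: satisfies_relations_def)
qed

lemma frame_hom_Sup: "frame_hom f \<Longrightarrow> f (Sup A) = Sup (f ` A)"
  by (simp add: frame_hom_def)

lemma frame_hom_SUP: "frame_hom f \<Longrightarrow> f (SUP i\<in>I. g i) = (SUP i\<in>I. f (g i))"
  by (simp add: frame_hom_Sup image_image)

lemma frame_hom_finite_Inf:
  assumes f: "frame_hom f" and "finite A"
  shows "f (Inf A) = Inf (f ` A)"
  using assms(2)
proof (induction A rule: finite_induct)
  case empty
  then show ?case using f by (simp add: frame_hom_def)
next
  case (insert a A)
  have "f (inf a (Inf A)) = inf (f a) (f (Inf A))" using f unfolding frame_hom_def by blast
  then show ?case using insert.IH by simp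
qed

lemma frame_hom_finite_INF: "frame_hom f \<Longrightarrow> finite I \<Longrightarrow> f (INF i\<in>I. g i) = (INF i\<in>I. f (g i))"
  by (simp add: frame_hom_finite_Inf image_image)

theorem presented_hom_eqI:
  assumes "frame_hom f" "frame_hom h" "\<And>g. f (generator g) = h (generator g)"
  shows "f = h"
proof
  fix U
  have *: "k U = (SUP F\<in>Rep_presented U. INF g\<in>F. k (generator g))" if k: "frame_hom k"
    for k :: "'a presented \<Rightarrow> 'b"
  proof -
    have "k U = k (SUP F\<in>Rep_presented U. Inf (generator ` F))"
      by (rule arg_cong[OF presented_eq_SUP])
    also have "\<dots> = (SUP F\<in>Rep_presented U. k (Inf (generator ` F)))"
      by (rule frame_hom_SUP[OF k])
    also have "\<dots> = (SUP F\<in>Rep_presented U. INF g\<in>F. k (generator g))"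
      by (rule SUP_cong[OF refl frame_hom_finite_INF[OF k Rep_presented_finite]])
    finally show ?thesis .
  qed
  show "f U = h U"
    unfolding *[OF assms(1)] *[OF assms(2)] assms(3) ..
qed

lemma satisfies_relations_frame_hom:
  assumes "frame_hom f"
  shows "satisfies_relations (\<lambda>g. f (generator g))"
proof -
  have "Inf ((\<lambda>g. f (generator g)) ` F) = (SUP G\<in>\<G>. Inf ((\<lambda>g. f (generator g)) ` G))"
    if r: "(F, \<G>) \<in> relations" for F \<G>
  proof -
    have fin: "finite F" "\<And>G. G \<in> \<G> \<Longrightarrow> finite G" using relations_finite[OF r] by auto
    have "f (Inf (generator ` F)) = f (SUP G\<in>\<G>. Inf (generator ` G))"
      using satisfies_relations_generator r unfolding satisfies_relations_def by fastforce
    also have "\<dots> = (SUP G\<in>\<G>. f (Inf (generator ` G)))"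
      by (rule frame_hom_SUP[OF assms])
    also have "\<dots> = (SUP G\<in>\<G>. Inf ((\<lambda>g. f (generator g)) ` G))"
      by (rule SUP_cong[OF refl frame_hom_finite_INF[OF assms fin(2)]])
    finally show ?thesis using frame_hom_finite_INF[OF assms fin(1)] by simp
  qed
  then show ?thesis by (auto simp: satisfies_relations_def)
qed

theorem presented_hom_exists:
  assumes v: "satisfies_relations v"
  shows "\<exists>f. frame_hom f \<and> (\<forall>g. f (generator g) = v g)"
proof -
  define f where "f U = (SUP F\<in>Rep_presented U. Inf (v ` F))" for U
  have sat: "saturated {F. finite F \<and> Inf (v ` F) \<le> w}" for w
  proof (rule saturatedI, goal_cases)
    case (2 F G)
    then show ?case by simp (meson Inf_superset_mono image_mono order_trans)
  next
    case (3 F \<G> H)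
    have "Inf (v ` (F \<union> H)) = (SUP G\<in>\<G>. inf (Inf (v ` G)) (Inf (v ` H)))"
      using v 3(1) by (auto simp: satisfies_relations_def image_Un Inf_union_distrib SUP_inf_frame)
    then show ?case using 3 by (simp add: SUP_le_iff image_Un Inf_union_distrib)
  qed simp
  have le: "U \<le> Abs_presented {F. finite F \<and> Inf (v ` F) \<le> w} \<longleftrightarrow> f U \<le> w" for U w
    unfolding f_def less_eq_presented.rep_eq
    by (auto simp: Abs_presented_inverse sat SUP_le_iff Rep_presented_finite)
  have top: "f top = top"
    unfolding f_def Rep_presented_top by (rule top_le, rule SUP_upper2[of "{}"]) auto
  have Sup: "f (Sup A) = Sup (f ` A)" for A
  proof -
    have "f (Sup A) \<le> w \<longleftrightarrow> Sup (f ` A) \<le> w" for w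
      by (simp add: Sup_le_iff flip: le)
    then show ?thesis by (metis antisym order_refl)
  qed
  have inf: "f (inf U V) = inf (f U) (f V)" for U V
  proof (rule antisym)
    show "f (inf U V) \<le> inf (f U) (f V)"
      unfolding f_def Rep_presented_inf by (auto intro!: SUP_least intro: SUP_upper)
    have "inf (Inf (v ` F)) (Inf (v ` G)) \<le> f (inf U V)"
      if "F \<in> Rep_presented U" "G \<in> Rep_presented V" for F G
    proof -
      have "finite (F \<union> G)" using that Rep_presented_finite by blast
      then have "F \<union> G \<in> Rep_presented (inf U V)"
        using that unfolding Rep_presented_inf by (auto intro: Rep_presented_mono)
      then show ?thesis
        unfolding f_def using SUP_upper[of "F \<union> G" _ "\<lambda>F. Inf (v ` F)"]
        by (simp add: image_Un Inf_union_distrib)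
    qed
    then show "inf (f U) (f V) \<le> f (inf U V)"
      unfolding f_def[of U] f_def[of V] by (simp add: SUP_inf_frame inf_SUP_frame SUP_le_iff)
  qed
  have "f (generator g) = v g" for g
  proof (rule antisym)
    show "f (generator g) \<le> v g"
      by (simp add: formal_meet_le_iff Abs_presented_inverse sat generator_def flip: le)
    have "{g} \<in> Rep_presented (generator g)"
      by (simp add: generator_def flip: formal_meet_le_iff)
    then show "v g \<le> f (generator g)"
      unfolding f_def by (rule SUP_upper2) simp
  qed
  then show ?thesis using top Sup inf by (auto simp: frame_hom_def)
qed


section \<open>The frames of reals and of extended partial reals\<close>

text \<open>\<open>Above p\<close> and \<open>Below q\<close> are the generators \<open>(p,-)\<close> and \<open>(-,q)\<close>.\<close>

datatype ir_gen = Above rat | Below rat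

instantiation ir_gen :: frame_presentation
begin

definition relations_ir_gen :: "(ir_gen set \<times> ir_gen set set) set" where
  "relations_ir_gen =
     {({Above p, Below q}, {}) | p q. p \<ge> q}
   \<union> {({Above p}, {{Above q} | q. q > p}) | p. True}
   \<union> {({Below p}, {{Below q} | q. q < p}) | p. True}"

instance by standard (auto simp: relations_ir_gen_def)

end

datatype r_gen = RAbove rat | RBelow rat

instantiation r_gen :: frame_presentation
begin

definition relations_r_gen :: "(r_gen set \<times> r_gen set set) set" where
  "relations_r_gen =
     {({RAbove p, RBelow q}, {}) | p q. p \<ge> q}
   \<union> {({}, {{RAbove p}, {RBelow q}}) | p q. p < q}
   \<union> {({RAbove p}, {{RAbove q} | q. q > p}) | p. True}
   \<union> {({RBelow p}, {{RBelow q} | q. q < p}) | p. True}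
   \<union> {({}, {{RAbove p} | p. True})}
   \<union> {({}, {{RBelow p} | p. True})}"

instance by standard (auto simp: relations_r_gen_def)

end

type_synonym ir_frame = "ir_gen presented"

type_synonym r_frame = "r_gen presented"

abbreviation ray_above :: "rat \<Rightarrow> ir_frame" where
  "ray_above p \<equiv> generator (Above p)"

abbreviation ray_below :: "rat \<Rightarrow> ir_frame" where
  "ray_below q \<equiv> generator (Below q)"

definition IC :: "(ir_frame \<Rightarrow> 'a::frame) set" where
  "IC = {f. frame_hom f}"

text \<open>Homomorphisms out of the frame of reals are represented by the members of \<^const>\<open>IC\<close>
  that satisfy the remaining relations; the theorem \<open>C_eq_r_frame_homs\<close> below justifies this.\<close>

definition C :: "(ir_frame \<Rightarrow> 'a::frame) set" where
  "C = {f \<in> IC. (\<forall>p q. p < q \<longrightarrow> sup (f (ray_above p)) (f (ray_below q)) = top)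
         \<and> (SUP p. f (ray_above p)) = top \<and> (SUP q. f (ray_below q)) = top}"

definition to_r_frame :: "ir_frame \<Rightarrow> r_frame" where
  "to_r_frame = (THE h. frame_hom h \<and> (\<forall>p. h (ray_above p) = generator (RAbove p))
                     \<and> (\<forall>q. h (ray_below q) = generator (RBelow q)))"

lemma SUP_singleton_image: "(SUP G\<in>{{c q} | q. P q}. Inf (v ` G)) = (SUP q\<in>{q. P q}. v (c q))"
  for v :: "'g \<Rightarrow> 'a::complete_lattice"
proof -
  have "{{c q} | q. P q} = (\<lambda>q. {c q}) ` {q. P q}" by auto
  then show ?thesis by (simp add: image_image)
qed

lemma ball_setcompr1: "(\<forall>r\<in>{c p | p. Q p}. P r) \<longleftrightarrow> (\<forall>p. Q p \<longrightarrow> P (c p))"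
  by blast

lemma ball_setcompr2: "(\<forall>r\<in>{c p q | p q. Q p q}. P r) \<longleftrightarrow> (\<forall>p q. Q p q \<longrightarrow> P (c p q))"
  by blast

lemma ball_singleton: "(\<forall>r\<in>{x}. P r) \<longleftrightarrow> P x"
  by blast

lemma satisfies_ir_iff:
  "satisfies_relations v \<longleftrightarrow>
     (\<forall>p q. p \<ge> q \<longrightarrow> inf (v (Above p)) (v (Below q)) = bot)
   \<and> (\<forall>p. v (Above p) = (SUP q\<in>{q. q > p}. v (Above q)))
   \<and> (\<forall>p. v (Below p) = (SUP q\<in>{q. q < p}. v (Below q)))"
proof -
  have "satisfies_relations v \<longleftrightarrow>
     (\<forall>p q. p \<ge> q \<longrightarrow> Inf (v ` {Above p, Below q}) = (SUP G\<in>{}. Inf (v ` G)))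
   \<and> (\<forall>p. Inf (v ` {Above p}) = (SUP G\<in>{{Above q} | q. q > p}. Inf (v ` G)))
   \<and> (\<forall>p. Inf (v ` {Below p}) = (SUP G\<in>{{Below q} | q. q < p}. Inf (v ` G)))"
    unfolding satisfies_relations_def relations_ir_gen_def ball_Un ball_setcompr1 ball_setcompr2
      prod.case by (simp only: simp_thms conj_assoc)
  then show ?thesis unfolding SUP_singleton_image by simp
qed

lemma satisfies_r_iff:
  "satisfies_relations v \<longleftrightarrow>
     (\<forall>p q. p \<ge> q \<longrightarrow> inf (v (RAbove p)) (v (RBelow q)) = bot)
   \<and> (\<forall>p q. p < q \<longrightarrow> sup (v (RAbove p)) (v (RBelow q)) = top)
   \<and> (\<forall>p. v (RAbove p) = (SUP q\<in>{q. q > p}. v (RAbove q)))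
   \<and> (\<forall>p. v (RBelow p) = (SUP q\<in>{q. q < p}. v (RBelow q)))
   \<and> (SUP p. v (RAbove p)) = top \<and> (SUP q. v (RBelow q)) = top"
proof -
  have "satisfies_relations v \<longleftrightarrow>
     (\<forall>p q. p \<ge> q \<longrightarrow> Inf (v ` {RAbove p, RBelow q}) = (SUP G\<in>{}. Inf (v ` G)))
   \<and> (\<forall>p q. p < q \<longrightarrow> Inf (v ` {}) = (SUP G\<in>{{RAbove p}, {RBelow q}}. Inf (v ` G)))
   \<and> (\<forall>p. Inf (v ` {RAbove p}) = (SUP G\<in>{{RAbove q} | q. q > p}. Inf (v ` G)))
   \<and> (\<forall>p. Inf (v ` {RBelow p}) = (SUP G\<in>{{RBelow q} | q. q < p}. Inf (v ` G)))
   \<and> Inf (v ` {}) = (SUP G\<in>{{RAbove p} | p. True}. Inf (v ` G))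
   \<and> Inf (v ` {}) = (SUP G\<in>{{RBelow p} | p. True}. Inf (v ` G))"
    unfolding satisfies_relations_def relations_r_gen_def ball_Un ball_setcompr1 ball_setcompr2
      ball_singleton prod.case by (simp only: simp_thms conj_assoc)
  then show ?thesis unfolding SUP_singleton_image by (simp add: eq_commute[of top])
qed

lemma all_ir_gen: "(\<forall>g. P g) \<longleftrightarrow> (\<forall>p. P (Above p)) \<and> (\<forall>q. P (Below q))"
  by (metis ir_gen.exhaust)

lemma all_r_gen: "(\<forall>g. P g) \<longleftrightarrow> (\<forall>p. P (RAbove p)) \<and> (\<forall>q. P (RBelow q))"
  by (metis r_gen.exhaust)

lemma ir_hom_eqI:
  assumes "frame_hom f" "frame_hom h" "\<And>p. f (ray_above p) = h (ray_above p)" "\<And>q. f (ray_below q) = h (ray_below q)"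
  shows "f = h"
  using presented_hom_eqI[OF assms(1,2)] all_ir_gen[of "\<lambda>g. f (generator g) = h (generator g)"] assms(3,4)
  by blast

lemma ir_hom_exists:
  assumes "\<And>p q. p \<ge> q \<Longrightarrow> inf (u p) (l q) = bot"
    and "\<And>p. u p = (SUP q\<in>{q. q > p}. u q)" and "\<And>p. l p = (SUP q\<in>{q. q < p}. l q)"
  shows "\<exists>f\<in>IC. (\<forall>p. f (ray_above p) = u p) \<and> (\<forall>q. f (ray_below q) = l q)"
proof -
  have "satisfies_relations (case_ir_gen u l)"
    unfolding satisfies_ir_iff ir_gen.case by (intro conjI allI impI) (fact assms)+
  then obtain f where "frame_hom f" "\<And>g. f (generator g) = case_ir_gen u l g"
    using presented_hom_exists by blast
  then show ?thesis by (intro bexI[of _ f]) (simp_all add: IC_def)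
qed

lemma ir_hom_relations:
  assumes "f \<in> IC"
  shows "p \<ge> q \<Longrightarrow> inf (f (ray_above p)) (f (ray_below q)) = bot"
    and "f (ray_above p) = (SUP q\<in>{q. q > p}. f (ray_above q))"
    and "f (ray_below p) = (SUP q\<in>{q. q < p}. f (ray_below q))"
proof -
  have "satisfies_relations (\<lambda>g. f (generator g))"
    using assms by (simp add: IC_def satisfies_relations_frame_hom)
  note * = this[unfolded satisfies_ir_iff]
  show "p \<ge> q \<Longrightarrow> inf (f (ray_above p)) (f (ray_below q)) = bot"
    by (rule *[THEN conjunct1, rule_format])
  show "f (ray_above p) = (SUP q\<in>{q. q > p}. f (ray_above q))"
    by (rule *[THEN conjunct2, THEN conjunct1, THEN spec])
  show "f (ray_below p) = (SUP q\<in>{q. q < p}. f (ray_below q))"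
    by (rule *[THEN conjunct2, THEN conjunct2, THEN spec])
qed

lemma to_r_frame:
  "frame_hom to_r_frame" "to_r_frame (ray_above p) = generator (RAbove p)"
  "to_r_frame (ray_below q) = generator (RBelow q)"
proof -
  let ?P = "\<lambda>h::ir_frame \<Rightarrow> r_frame. frame_hom h \<and> (\<forall>p. h (ray_above p) = generator (RAbove p))
                     \<and> (\<forall>q. h (ray_below q) = generator (RBelow q))"
  have "\<exists>h\<in>IC. (\<forall>p. h (ray_above p) = generator (RAbove p)) \<and> (\<forall>q. h (ray_below q) = generator (RBelow q))"
  proof (rule ir_hom_exists)
    note * = satisfies_relations_generator[where 'a = r_gen, unfolded satisfies_r_iff]
    show "p \<ge> q \<Longrightarrow> inf (generator (RAbove p)) (generator (RBelow q)) = bot" for p q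
      by (rule *[THEN conjunct1, rule_format])
    show "generator (RAbove p) = (SUP q\<in>{q. q > p}. generator (RAbove q))" for p
      by (rule *[THEN conjunct2, THEN conjunct2, THEN conjunct1, THEN spec])
    show "generator (RBelow p) = (SUP q\<in>{q. q < p}. generator (RBelow q))" for p
      by (rule *[THEN conjunct2, THEN conjunct2, THEN conjunct2, THEN conjunct1, THEN spec])
  qed
  then obtain h where h: "?P h" unfolding IC_def by blast
  moreover have "h' = h" if "?P h'" for h'
    using that h by (intro ir_hom_eqI) auto
  ultimately have "?P to_r_frame" unfolding to_r_frame_def by (rule theI)
  then show "frame_hom to_r_frame" "to_r_frame (ray_above p) = generator (RAbove p)"
    "to_r_frame (ray_below q) = generator (RBelow q)" by auto
qed

theorem C_eq_r_frame_homs: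
  "bij_betw (\<lambda>h. h \<circ> to_r_frame) {h :: r_frame \<Rightarrow> 'a::frame. frame_hom h} C"
  unfolding bij_betw_def
proof
  show "inj_on (\<lambda>h. h \<circ> to_r_frame) {h :: r_frame \<Rightarrow> 'a. frame_hom h}"
  proof (rule inj_onI)
    fix h k :: "r_frame \<Rightarrow> 'a"
    assume hk: "h \<in> {h. frame_hom h}" "k \<in> {h. frame_hom h}" "h \<circ> to_r_frame = k \<circ> to_r_frame"
    have "\<forall>g. h (generator g) = k (generator g)"
      using fun_cong[OF hk(3)] unfolding all_r_gen by (metis comp_apply to_r_frame(2,3))
    with hk show "h = k" by (intro presented_hom_eqI) auto
  qed
  show "(\<lambda>h. h \<circ> to_r_frame) ` {h :: r_frame \<Rightarrow> 'a. frame_hom h} = C"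
  proof (intro equalityI subsetI)
    fix f :: "ir_frame \<Rightarrow> 'a"
    assume "f \<in> (\<lambda>h. h \<circ> to_r_frame) ` {h. frame_hom h}"
    then obtain h where h: "frame_hom h" "f = h \<circ> to_r_frame" by auto
    note * = satisfies_relations_frame_hom[OF h(1), unfolded satisfies_r_iff]
    have "frame_hom f" using h to_r_frame(1) by (simp add: frame_hom_def image_comp)
    moreover have "\<forall>p q. p < q \<longrightarrow> sup (f (ray_above p)) (f (ray_below q)) = top"
      using *[THEN conjunct2, THEN conjunct1] by (simp add: h(2) to_r_frame)
    moreover have "(SUP p. f (ray_above p)) = top"
      using *[THEN conjunct2, THEN conjunct2, THEN conjunct2, THEN conjunct2, THEN conjunct1]
      by (simp add: h(2) to_r_frame)
    moreover have "(SUP q. f (ray_below q)) = top"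
      using *[THEN conjunct2, THEN conjunct2, THEN conjunct2, THEN conjunct2, THEN conjunct2]
      by (simp add: h(2) to_r_frame)
    ultimately show "f \<in> C" by (simp add: C_def IC_def)
  next
    fix f :: "ir_frame \<Rightarrow> 'a"
    assume f: "f \<in> C"
    then have f': "f \<in> IC" by (simp add: C_def)
    let ?v = "case_r_gen (\<lambda>p. f (ray_above p)) (\<lambda>q. f (ray_below q))"
    have "satisfies_relations ?v"
      unfolding satisfies_r_iff r_gen.case using f
      by (intro conjI allI impI ir_hom_relations[OF f']) (simp_all add: C_def)
    then obtain h where h: "frame_hom h" "\<forall>g. h (generator g) = ?v g"
      using presented_hom_exists by blast
    have "frame_hom (h \<circ> to_r_frame)" using h to_r_frame(1) by (simp add: frame_hom_def image_comp)
    then have "f = h \<circ> to_r_frame"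
      using f' h by (intro ir_hom_eqI) (auto simp: IC_def to_r_frame)
    then show "f \<in> (\<lambda>h. h \<circ> to_r_frame) ` {h. frame_hom h}" using h by blast
  qed
qed

definition cozero :: "'a::frame \<Rightarrow> bool" where
  "cozero a \<longleftrightarrow> (\<exists>f\<in>C. a = sup (f (ray_below 0)) (f (ray_above 0)))"

definition P_frame :: "'a::frame itself \<Rightarrow> bool" where
  "P_frame _ \<longleftrightarrow> (\<forall>a::'a. cozero a \<longrightarrow> complemented a)"

definition hausdorff_continuous :: "(ir_frame \<Rightarrow> 'a::frame) \<Rightarrow> bool" where
  "hausdorff_continuous f \<longleftrightarrow> f \<in> IC \<and>
     (\<forall>p q. p < q \<longrightarrow> pcomp (f (ray_above p)) \<le> f (ray_below q) \<and> pcomp (f (ray_below q)) \<le> f (ray_above p))"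

definition nearly_finite :: "(ir_frame \<Rightarrow> 'a::frame) \<Rightarrow> bool" where
  "nearly_finite f \<longleftrightarrow> pcomp (pcomp (SUP p. f (ray_above p))) = top
     \<and> pcomp (pcomp (SUP q. f (ray_below q))) = top"

definition H_nf :: "(ir_frame \<Rightarrow> 'a::frame) set" where
  "H_nf = {f. hausdorff_continuous f \<and> nearly_finite f}"


section \<open>Riesz spaces\<close>

record 'v riesz =
  carrier :: "'v set"
  le :: "'v \<Rightarrow> 'v \<Rightarrow> bool"
  zero :: 'v
  add :: "'v \<Rightarrow> 'v \<Rightarrow> 'v"
  scale :: "real \<Rightarrow> 'v \<Rightarrow> 'v"
  join :: "'v \<Rightarrow> 'v \<Rightarrow> 'v"
  meet :: "'v \<Rightarrow> 'v \<Rightarrow> 'v"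

definition riesz_iso :: "'v riesz \<Rightarrow> 'w riesz \<Rightarrow> ('v \<Rightarrow> 'w) \<Rightarrow> bool" where
  "riesz_iso E F \<phi> \<longleftrightarrow> bij_betw \<phi> (carrier E) (carrier F)
     \<and> (\<forall>f\<in>carrier E. \<forall>g\<in>carrier E. \<phi> (add E f g) = add F (\<phi> f) (\<phi> g)
          \<and> \<phi> (join E f g) = join F (\<phi> f) (\<phi> g) \<and> \<phi> (meet E f g) = meet F (\<phi> f) (\<phi> g))
     \<and> (\<forall>c. \<forall>f\<in>carrier E. \<phi> (scale E c f) = scale F c (\<phi> f))"

definition riesz_isomorphic :: "'v riesz \<Rightarrow> 'w riesz \<Rightarrow> bool" where
  "riesz_isomorphic E F \<longleftrightarrow> (\<exists>\<phi>. riesz_iso E F \<phi>)"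

definition is_supremum :: "'v riesz \<Rightarrow> 'v set \<Rightarrow> 'v \<Rightarrow> bool" where
  "is_supremum E S x \<longleftrightarrow> x \<in> carrier E \<and> (\<forall>s\<in>S. le E s x)
     \<and> (\<forall>y\<in>carrier E. (\<forall>s\<in>S. le E s y) \<longrightarrow> le E x y)"

definition dedekind_complete :: "'v riesz \<Rightarrow> bool" where
  "dedekind_complete E \<longleftrightarrow> (\<forall>S\<subseteq>carrier E. S \<noteq> {} \<and> (\<exists>y\<in>carrier E. \<forall>s\<in>S. le E s y)
     \<longrightarrow> (\<exists>x. is_supremum E S x))"

text \<open>For positive \<open>f\<close> and \<open>g\<close>, disjointness \<open>\<bar>f\<bar> \<and> \<bar>g\<bar> = 0\<close> reads \<open>f \<and> g = 0\<close>.\<close>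

definition laterally_complete :: "'v riesz \<Rightarrow> bool" where
  "laterally_complete E \<longleftrightarrow> (\<forall>S\<subseteq>carrier E. S \<noteq> {} \<and> (\<forall>f\<in>S. le E (zero E) f)
     \<and> (\<forall>f\<in>S. \<forall>g\<in>S. f \<noteq> g \<longrightarrow> meet E f g = zero E)
     \<longrightarrow> (\<exists>x. is_supremum E S x))"

definition universally_complete :: "'v riesz \<Rightarrow> bool" where
  "universally_complete E \<longleftrightarrow> dedekind_complete E \<and> laterally_complete E"


section \<open>The Riesz space of continuous real functions on a frame\<close>

definition C_le :: "(ir_frame \<Rightarrow> 'a::frame) \<Rightarrow> (ir_frame \<Rightarrow> 'a) \<Rightarrow> bool" where
  "C_le f g \<longleftrightarrow> (\<forall>p. f (ray_above p) \<le> g (ray_above p))"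

definition C_zero :: "ir_frame \<Rightarrow> 'a::frame" where
  "C_zero = (THE h. h \<in> C \<and> (\<forall>p. h (ray_above p) = (if p < 0 then top else bot))
                      \<and> (\<forall>q. h (ray_below q) = (if 0 < q then top else bot)))"

definition C_add :: "(ir_frame \<Rightarrow> 'a::frame) \<Rightarrow> (ir_frame \<Rightarrow> 'a) \<Rightarrow> ir_frame \<Rightarrow> 'a" where
  "C_add f g = (THE h. h \<in> C \<and> (\<forall>p. h (ray_above p) = (SUP r. inf (f (ray_above r)) (g (ray_above (p - r)))))
                        \<and> (\<forall>q. h (ray_below q) = (SUP s. inf (f (ray_below s)) (g (ray_below (q - s))))))"

definition C_uminus :: "(ir_frame \<Rightarrow> 'a::frame) \<Rightarrow> ir_frame \<Rightarrow> 'a" where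
  "C_uminus f = (THE h. h \<in> C \<and> (\<forall>p. h (ray_above p) = f (ray_below (- p)))
                        \<and> (\<forall>q. h (ray_below q) = f (ray_above (- q))))"

definition C_scale_pos :: "real \<Rightarrow> (ir_frame \<Rightarrow> 'a::frame) \<Rightarrow> ir_frame \<Rightarrow> 'a" where
  "C_scale_pos c f =
     (THE h. h \<in> C \<and> (\<forall>p. h (ray_above p) = Sup {f (ray_above r) | r. c * of_rat r > of_rat p})
                   \<and> (\<forall>q. h (ray_below q) = Sup {f (ray_below s) | s. c * of_rat s < of_rat q}))"

definition C_scale :: "real \<Rightarrow> (ir_frame \<Rightarrow> 'a::frame) \<Rightarrow> ir_frame \<Rightarrow> 'a" where
  "C_scale c f = (if c > 0 then C_scale_pos c f
                  else if c = 0 then C_zero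
                  else C_uminus (C_scale_pos (- c) f))"

text \<open>A member of \<^const>\<open>C\<close> is determined by its values on the elements \<^term>\<open>ray_above p\<close>; see
  \<open>C_eqI\<close> below.\<close>

definition C_join :: "(ir_frame \<Rightarrow> 'a::frame) \<Rightarrow> (ir_frame \<Rightarrow> 'a) \<Rightarrow> ir_frame \<Rightarrow> 'a" where
  "C_join f g = (THE h. h \<in> C \<and> (\<forall>p. h (ray_above p) = sup (f (ray_above p)) (g (ray_above p))))"

definition C_meet :: "(ir_frame \<Rightarrow> 'a::frame) \<Rightarrow> (ir_frame \<Rightarrow> 'a) \<Rightarrow> ir_frame \<Rightarrow> 'a" where
  "C_meet f g = (THE h. h \<in> C \<and> (\<forall>p. h (ray_above p) = inf (f (ray_above p)) (g (ray_above p))))"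

definition C_riesz :: "(ir_frame \<Rightarrow> 'a::frame) riesz" where
  "C_riesz = \<lparr>carrier = C, le = C_le, zero = C_zero, add = C_add, scale = C_scale,
              join = C_join, meet = C_meet\<rparr>"

lemma C_below_eq:
  assumes "f \<in> C"
  shows "f (ray_below q) = (SUP r\<in>{r. r < q}. pcomp (f (ray_above r)))"
proof (rule antisym)
  have f: "f \<in> IC" using assms by (simp add: C_def)
  have "f (ray_below r) \<le> pcomp (f (ray_above r))" for r
    using ir_hom_relations(1)[OF f, of r r] by (simp add: le_pcomp_iff)
  then show "f (ray_below q) \<le> (SUP r\<in>{r. r < q}. pcomp (f (ray_above r)))"
    by (subst ir_hom_relations(3)[OF f]) (rule SUP_mono, blast)
  have "pcomp (f (ray_above r)) \<le> f (ray_below q)" if "r < q" for r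
  proof -
    have "pcomp (f (ray_above r)) = inf (pcomp (f (ray_above r))) (SUP x\<in>{f (ray_above r), f (ray_below q)}. x)"
      using assms that by (simp add: C_def)
    also have "\<dots> = sup (inf (pcomp (f (ray_above r))) (f (ray_above r))) (inf (pcomp (f (ray_above r))) (f (ray_below q)))"
      by (simp only: inf_SUP_frame) simp
    also have "inf (pcomp (f (ray_above r))) (f (ray_above r)) = bot"
      using le_pcomp_iff[of "pcomp (f (ray_above r))" "f (ray_above r)"] by (simp add: inf_commute)
    finally show ?thesis by (simp add: inf.absorb_iff1 eq_commute)
  qed
  then show "(SUP r\<in>{r. r < q}. pcomp (f (ray_above r))) \<le> f (ray_below q)"
    by (auto intro: SUP_least)
qed

theorem C_eqI:
  assumes "f \<in> C" "g \<in> C" "\<And>p. f (ray_above p) = g (ray_above p)"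
  shows "f = g"
  using assms by (intro ir_hom_eqI) (auto simp: C_below_eq, auto simp: C_def IC_def)

end

theory Submission
  imports Defs "HOL-Library.Countable"
begin

text \<open>In an extremally disconnected frame every cozero element is a countable join of complemented
  elements, and conversely every such join is a cozero.  So the frames in (1) are those in which
  countable joins of complemented elements, and all pseudocomplements, are complemented.

  (1) and (2) are equivalent because a two-valued function, and a function taking the value \<open>n\<close> on the
  \<open>n\<close>-th piece of a partition, are Hausdorff continuous and belong to \<open>C\<close> only if the pieces cover.
  Under (1), composition with the dense quotient \<open>a \<mapsto> a\<^sup>*\<^sup>*\<close> onto the Booleanization is the
  isomorphism in (3).  The Booleanization satisfies (1) itself, and (1) implies (4) since suprema can be
  formed pointwise and regularised; so (3) gives (4).  For (4) implies (1), Dedekind completeness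
  is applied to the Urysohn functions below an element, and lateral completeness to multiples of
  indicators of disjoint complemented elements.\<close>


section \<open>Pseudocomplements\<close>

text \<open>Joining rays pointwise can destroy both the covering relation and finiteness, so
  infinite constructions inside \<open>C\<close> need care. Most of them run through one criterion:
  a family \<open>V\<close> indexed by the rationals, decreasing for \<open>\<prec>\<close>, such
  that the members and their pseudocomplements each join to top, becomes a function once its rays
  are made right-continuous. Between complemented elements \<open>\<prec>\<close> is mere order, so
  after double pseudocomplementation extremal disconnectedness supplies the first condition. The two
  joins may then be known only to be dense; but they are joins of complemented elements over the
  rationals, so the P-frame condition makes them complemented, hence equal to top. Double
  pseudocomplementation does no harm to functions, since \<open>b \<prec> a\<close> forces
  \<open>pcomp (pcomp b) \<le> a\<close>: a regularised ray fits under every ray of smaller index,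
  and right-continuity removes the shift. Complete regularity enters on the way from (4) to (1),
  where it provides enough functions to detect an element from below.\<close>

instance frame \<subseteq> distrib_lattice
proof
  fix x y z :: 'a
  have "inf x (sup y z) = sup (inf x y) (inf x z)" for x y z :: 'a
    using inf_Sup_frame[of x "{y, z}"] by simp
  then show "sup x (inf y z) = inf (sup x y) (sup x z)" by (rule distrib_imp1)
qed

lemma inf_SUP_SUP_le:
  fixes F :: "'i \<Rightarrow> 'a::frame"
  assumes "\<And>i j. i \<in> I \<Longrightarrow> j \<in> J \<Longrightarrow> inf (F i) (G j) \<le> c"
  shows "inf (SUP i\<in>I. F i) (SUP j\<in>J. G j) \<le> c"
  by (auto simp: SUP_inf_frame inf_SUP_frame intro!: SUP_least assms)

lemma inf_pcomp [simp]: "inf a (pcomp a) = bot" "inf (pcomp a) a = bot" for a :: "'a::frame"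
  using le_pcomp_iff[of "pcomp a" a] by (simp_all add: inf_commute)

lemma pcomp_bot [simp]: "pcomp bot = (top :: 'a::frame)"
  by (rule top_le) (simp add: le_pcomp_iff)

lemma pcomp_top [simp]: "pcomp top = (bot :: 'a::frame)"
  using inf_pcomp(1)[of "top :: 'a"] by (simp del: inf_pcomp)

lemma pcomp_sup: "pcomp (sup a b) = inf (pcomp a) (pcomp b)" for a :: "'a::frame"
proof (rule antisym)
  have "inf a (inf (pcomp a) (pcomp b)) = bot"
    by (simp only: inf_assoc[symmetric] inf_pcomp inf_bot_left)
  moreover have "inf b (inf (pcomp a) (pcomp b)) = bot"
    by (simp only: inf_left_commute[of b] inf_pcomp inf_bot_right)
  ultimately show "inf (pcomp a) (pcomp b) \<le> pcomp (sup a b)"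
    by (simp only: le_pcomp_iff inf_sup_distrib2 sup_bot_left)
qed (simp add: pcomp_antimono)

text \<open>The nontrivial inequality starts from \<open>inf a b\<close> being disjoint from its own
  pseudocomplement; disjointness survives replacing first \<open>a\<close> and then \<open>b\<close>
  by its double pseudocomplement.\<close>

lemma pcomp_pcomp_inf:
  "pcomp (pcomp (inf a b)) = inf (pcomp (pcomp a)) (pcomp (pcomp b))" for a :: "'a::frame"
proof (rule antisym)
  have "inf (inf a b) (pcomp (inf a b)) = bot" by simp
  then have "inf a (inf b (pcomp (inf a b))) = bot" by (simp only: inf_assoc)
  then have "inf b (inf (pcomp (pcomp a)) (pcomp (inf a b))) = bot"
    by (subst inf_left_commute) (rule inf_pcomp_pcomp_eq_bot)
  then have "inf (pcomp (pcomp b)) (inf (pcomp (pcomp a)) (pcomp (inf a b))) = bot"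
    by (rule inf_pcomp_pcomp_eq_bot)
  then have "inf (pcomp (inf a b)) (inf (pcomp (pcomp a)) (pcomp (pcomp b))) = bot"
    by (simp only: inf.commute inf.left_commute)
  then show "inf (pcomp (pcomp a)) (pcomp (pcomp b)) \<le> pcomp (pcomp (inf a b))"
    by (simp add: le_pcomp_iff)
qed (simp add: pcomp_pcomp_mono)

lemma pcomp_pcomp_SUP:
  "pcomp (pcomp (SUP i\<in>I. pcomp (pcomp (f i)))) = pcomp (pcomp (SUP i\<in>I. f i))" for f :: "'i \<Rightarrow> 'a::frame"
proof (rule antisym)
  have "(SUP i\<in>I. pcomp (pcomp (f i))) \<le> pcomp (pcomp (SUP i\<in>I. f i))"
    by (intro SUP_least pcomp_pcomp_mono SUP_upper)
  then show "pcomp (pcomp (SUP i\<in>I. pcomp (pcomp (f i)))) \<le> pcomp (pcomp (SUP i\<in>I. f i))"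
    by (metis pcomp_pcomp_mono pcomp_pcomp_pcomp)
  show "pcomp (pcomp (SUP i\<in>I. f i)) \<le> pcomp (pcomp (SUP i\<in>I. pcomp (pcomp (f i))))"
    by (intro pcomp_pcomp_mono SUP_mono) (blast intro: le_pcomp_pcomp)
qed

text \<open>Case distinction along a cover, the substitute for Boolean reasoning in a frame.\<close>

lemma le_if_sup_eq_top_inf_le: "sup a b = top \<Longrightarrow> inf x a \<le> c \<Longrightarrow> inf x b \<le> c \<Longrightarrow> x \<le> c"
  for x :: "'a::frame"
  by (metis inf_sup_distrib1 inf_top_right le_sup_iff)

text \<open>Of the cover by \<open>pcomp b\<close> and \<open>a\<close>, the first member is
  disjoint from \<open>pcomp (pcomp b)\<close>. This is how regularisations of rays are absorbed
  later.\<close>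

lemma rather_below_pcomp_pcomp_le: "b \<prec> a \<Longrightarrow> pcomp (pcomp b) \<le> a" for a :: "'a::frame"
  unfolding rather_below_def by (erule le_if_sup_eq_top_inf_le) (simp_all add: le_infI2)

lemma rather_below_le: "b \<prec> a \<Longrightarrow> b \<le> a" for a :: "'a::frame"
  by (rule order_trans[OF le_pcomp_pcomp rather_below_pcomp_pcomp_le])

lemma rather_below_mono: "b \<prec> a \<Longrightarrow> b' \<le> b \<Longrightarrow> a \<le> a' \<Longrightarrow> b' \<prec> a'" for a :: "'a::frame"
  unfolding rather_below_def by (metis pcomp_antimono sup_mono top.extremum_unique)

lemma rather_below_sup:
  fixes a b :: "'a::frame"
  assumes "a \<prec> b" "a' \<prec> b'"
  shows "sup a a' \<prec> sup b b'"
proof -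
  have "sup (pcomp a) (sup b b') = top"
    using assms(1) by (simp only: rather_below_def sup_assoc[symmetric] sup_top_left)
  moreover have "sup (pcomp a') (sup b b') = top"
    using assms(2) by (simp only: rather_below_def sup_left_commute[of _ b] sup_top_right)
  ultimately show ?thesis by (simp add: rather_below_def pcomp_sup sup_inf_distrib2)
qed

lemma rather_below_top [simp]: "a \<prec> top" and bot_rather_below [simp]: "bot \<prec> a" for a :: "'a::frame"
  by (simp_all add: rather_below_def)

section \<open>Complemented elements\<close>

lemma complementedI: "sup a b = top \<Longrightarrow> inf a b = bot \<Longrightarrow> complemented a" for a :: "'a::frame"
  unfolding complemented_def by (metis le_pcomp_iff sup_mono order_refl top_le)

text \<open>Makes the condition on scales automatic: a decreasing family of complemented elements
  already decreases for \<open>\<prec>\<close>.\<close>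

lemma complemented_rather_below: "complemented a \<Longrightarrow> a \<le> b \<Longrightarrow> a \<prec> b" for a :: "'a::frame"
  unfolding complemented_def rather_below_def by (metis sup_mono order_refl top_le sup_commute)

lemma complemented_pcomp_pcomp: "complemented a \<Longrightarrow> pcomp (pcomp a) = a" for a :: "'a::frame"
  by (simp add: antisym complemented_rather_below le_pcomp_pcomp rather_below_pcomp_pcomp_le)

lemma complemented_pcomp: "complemented a \<Longrightarrow> complemented (pcomp a)" for a :: "'a::frame"
  by (rule complementedI[of _ a]) (simp_all add: complemented_def sup_commute)

lemma complemented_bot: "complemented (bot :: 'a::frame)"
  by (simp add: complemented_def)

lemma complemented_sup: "complemented a \<Longrightarrow> complemented b \<Longrightarrow> complemented (sup a b)" for a :: "'a::frame"
  using rather_below_sup[of a a b b] by (simp add: complemented_def rather_below_def sup_commute)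

lemma
  fixes a b :: "'a::frame"
  assumes "complemented a" "complemented b"
  shows pcomp_inf_complemented: "pcomp (inf a b) = sup (pcomp a) (pcomp b)"
    and complemented_inf: "complemented (inf a b)"
proof -
  have sup: "complemented (sup (pcomp a) (pcomp b))"
    using assms by (intro complemented_sup complemented_pcomp)
  have inf: "inf a b = pcomp (sup (pcomp a) (pcomp b))"
    using assms by (simp add: pcomp_sup complemented_pcomp_pcomp)
  show "pcomp (inf a b) = sup (pcomp a) (pcomp b)"
    unfolding inf by (rule complemented_pcomp_pcomp[OF sup])
  show "complemented (inf a b)"
    unfolding inf by (rule complemented_pcomp[OF sup])
qed

lemma complemented_finite_SUP:
  "finite I \<Longrightarrow> (\<And>i. i \<in> I \<Longrightarrow> complemented (b i)) \<Longrightarrow> complemented (SUP i\<in>I. b i)"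
  for b :: "'i \<Rightarrow> 'a::frame"
  by (induction I rule: finite_induct) (simp_all add: complemented_bot complemented_sup)

text \<open>Turns density, which is all that pseudocomplements can detect, into a cover.\<close>

lemma complemented_dense: "complemented a \<Longrightarrow> pcomp a = bot \<Longrightarrow> a = top" for a :: "'a::frame"
  by (simp add: complemented_def)

lemma extremally_disconnected_complemented:
  "extremally_disconnected TYPE('a) \<Longrightarrow> complemented (pcomp a)" for a :: "'a::frame"
  by (simp add: extremally_disconnected_def complemented_def)


section \<open>Constructing real functions\<close>

lemma C_exists:
  fixes u l :: "rat \<Rightarrow> 'a::frame"
  assumes "\<And>p q. p \<ge> q \<Longrightarrow> inf (u p) (l q) = bot"
    and "\<And>p q. p < q \<Longrightarrow> sup (u p) (l q) = top"
    and "\<And>p. u p \<le> (SUP q\<in>{q. q > p}. u q)" "\<And>p q. p < q \<Longrightarrow> u q \<le> u p"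
    and "\<And>p. l p \<le> (SUP q\<in>{q. q < p}. l q)" "\<And>p q. p < q \<Longrightarrow> l p \<le> l q"
    and "(SUP p. u p) = top" "(SUP q. l q) = top"
  shows "\<exists>f\<in>C. (\<forall>p. f (ray_above p) = u p) \<and> (\<forall>q. f (ray_below q) = l q)"
proof -
  have "\<exists>f\<in>IC. (\<forall>p. f (ray_above p) = u p) \<and> (\<forall>q. f (ray_below q) = l q)"
    using assms(1,3-6) by (intro ir_hom_exists antisym) (auto intro: SUP_least)
  then show ?thesis using assms by (auto simp: C_def)
qed

section \<open>Relations between the rays of a real function\<close>

lemma
  assumes "f \<in> C"
  shows C_disjoint: "p \<ge> q \<Longrightarrow> inf (f (ray_above p)) (f (ray_below q)) = bot"
    and C_cover: "p < q \<Longrightarrow> sup (f (ray_above p)) (f (ray_below q)) = top"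
    and C_above: "(SUP q\<in>{q. q > p}. f (ray_above q)) = f (ray_above p)"
    and C_below: "(SUP q\<in>{q. q < p}. f (ray_below q)) = f (ray_below p)"
    and C_SUP_above: "(SUP p. f (ray_above p)) = top"
    and C_SUP_below: "(SUP q. f (ray_below q)) = top"
  using assms ir_hom_relations[of f, symmetric] by (auto simp: C_def)

lemma C_above_antimono: "f \<in> C \<Longrightarrow> p \<le> q \<Longrightarrow> f (ray_above q) \<le> f (ray_above p)"
  using C_above[of f p] by (cases "p = q") (auto simp flip: C_above[of f p] intro: SUP_upper)

lemma C_below_mono: "f \<in> C \<Longrightarrow> p \<le> q \<Longrightarrow> f (ray_below p) \<le> f (ray_below q)"
  using C_below[of f q] by (cases "p = q") (auto simp flip: C_below[of f q] intro: SUP_upper)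

lemma rather_belowI: "sup a c = top \<Longrightarrow> inf b c = bot \<Longrightarrow> b \<prec> a" for a :: "'a::frame"
  unfolding rather_below_def
  by (rule top_le) (metis le_pcomp_iff order_refl sup_commute sup_mono)

lemma C_above_rather_below: "f \<in> C \<Longrightarrow> p < q \<Longrightarrow> f (ray_above q) \<prec> f (ray_above p)"
  by (rule rather_belowI[of _ "f (ray_below q)"]) (simp_all add: C_cover C_disjoint)

lemma C_below_rather_below: "f \<in> C \<Longrightarrow> p < q \<Longrightarrow> f (ray_below p) \<prec> f (ray_below q)"
  by (rule rather_belowI[of _ "f (ray_above p)"])
    (simp_all add: C_cover C_disjoint sup_commute[of "f (ray_below q)"] inf_commute[of "f (ray_below p)"])

lemma C_above_pcomp_pcomp_le:
  "f \<in> C \<Longrightarrow> p < q \<Longrightarrow> pcomp (pcomp (f (ray_above q))) \<le> f (ray_above p)"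
  by (intro rather_below_pcomp_pcomp_le C_above_rather_below)

lemma C_SUP_pcomp_above:
  assumes f: "f \<in> C"
  shows "(SUP p. pcomp (f (ray_above p))) = top"
proof (rule top_le)
  have "f (ray_below q) \<le> pcomp (f (ray_above q))" for q
    by (simp add: le_pcomp_iff C_disjoint[OF f])
  then have "(SUP q. f (ray_below q)) \<le> (SUP p. pcomp (f (ray_above p)))"
    by (intro SUP_mono) auto
  then show "top \<le> (SUP p. pcomp (f (ray_above p)))" by (simp add: C_SUP_below[OF f])
qed

text \<open>The upper rays are the right-continuous version of \<open>V\<close>, and the lower rays
  are modelled on \<open>C_below_eq\<close>. The relation \<open>\<prec>\<close> yields the covering
  relation; the two joins being top express finiteness from below and from above.\<close>

lemma C_exists_above:
  fixes V :: "rat \<Rightarrow> 'a::frame"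
  assumes V: "\<And>p q. p < q \<Longrightarrow> V q \<prec> V p"
    and "(SUP p. V p) = top" "(SUP p. pcomp (V p)) = top"
  shows "\<exists>f\<in>C. \<forall>p. f (ray_above p) = (SUP q\<in>{q. q > p}. V q)"
proof -
  let ?u = "\<lambda>p. SUP q\<in>{q. q > p}. V q" and ?l = "\<lambda>q. SUP r\<in>{r. r < q}. pcomp (V r)"
  note mono = rather_below_le[OF V]
  have "\<exists>f\<in>C. (\<forall>p. f (ray_above p) = ?u p) \<and> (\<forall>q. f (ray_below q) = ?l q)"
  proof (rule C_exists)
    fix p q :: rat
    show "inf (?u p) (?l q) = bot" if "p \<ge> q"
    proof (rule bot_unique[THEN iffD1], rule inf_SUP_SUP_le)
      fix i j assume "i \<in> {q. q > p}" "j \<in> {r. r < q}"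
      then have "V i \<le> V j" using that by (intro mono) auto
      then show "inf (V i) (pcomp (V j)) \<le> bot" by (metis inf_mono inf_pcomp(1) order_refl)
    qed
    show "sup (?u p) (?l q) = top" if pq: "p < q"
    proof -
      obtain r s where rs: "p < r" "r < s" "s < q" using pq dense by metis
      have "sup (V r) (pcomp (V s)) = top"
        using V[OF rs(2)] by (simp add: rather_below_def sup_commute)
      moreover have "sup (V r) (pcomp (V s)) \<le> sup (?u p) (?l q)"
        using rs by (intro sup_mono SUP_upper) auto
      ultimately show ?thesis by (simp add: top_unique)
    qed
    show "?u p \<le> (SUP q\<in>{q. q > p}. ?u q)"
    proof (rule SUP_least)
      fix q assume "q \<in> {q. q > p}"
      then obtain r where "p < r" "r < q" using dense by blast
      then show "V q \<le> (SUP q\<in>{q. q > p}. ?u q)"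
        by (intro SUP_upper2[of r] SUP_upper) auto
    qed
    show "?l p \<le> (SUP q\<in>{q. q < p}. ?l q)"
    proof (rule SUP_least)
      fix q assume "q \<in> {q. q < p}"
      then obtain r where "q < r" "r < p" using dense by blast
      then show "pcomp (V q) \<le> (SUP q\<in>{q. q < p}. ?l q)"
        by (intro SUP_upper2[of r] SUP_upper) auto
    qed
    show "?u q \<le> ?u p" "?l p \<le> ?l q" if "p < q"
      using that by (auto intro!: SUP_subset_mono)
    have "(SUP p. V p) \<le> (SUP p. ?u p)"
    proof (rule SUP_least)
      fix q show "V q \<le> (SUP p. ?u p)" by (intro SUP_upper2[of "q - 1"] SUP_upper) auto
    qed
    then show "(SUP p. ?u p) = top" using assms(2) by (simp add: top_unique)
    have "(SUP p. pcomp (V p)) \<le> (SUP p. ?l p)"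
    proof (rule SUP_least)
      fix q show "pcomp (V q) \<le> (SUP p. ?l p)" by (intro SUP_upper2[of "q + 1"] SUP_upper) auto
    qed
    then show "(SUP p. ?l p) = top" using assms(3) by (simp add: top_unique)
  qed
  then show ?thesis by blast
qed

section \<open>Step functions, and existence of the algebraic operations\<close>

lemma C_exists_indicator:
  fixes d :: "'a::frame"
  assumes "complemented d" and x: "0 \<le> x"
  shows "\<exists>f\<in>C. \<forall>p. f (ray_above p) = (if p < 0 then top else if p < x then d else bot)"
proof -
  let ?V = "\<lambda>p. if p < 0 then top else if p < x then d else bot"
  have "\<exists>f\<in>C. \<forall>p. f (ray_above p) = (SUP q\<in>{q. q > p}. ?V q)"
  proof (rule C_exists_above)
    show "?V q \<prec> ?V p" if "p < q" for p q
      using that complemented_rather_below[OF assms(1)] by auto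
    show "(SUP p. ?V p) = top" by (rule top_le, rule SUP_upper2[of "-1"]) auto
    show "(SUP p. pcomp (?V p)) = top" by (rule top_le, rule SUP_upper2[of x]) (use x in auto)
  qed
  moreover have "(SUP q\<in>{q. q > p}. ?V q) = ?V p" for p
  proof (rule antisym)
    show "(SUP q\<in>{q. q > p}. ?V q) \<le> ?V p" by (rule SUP_least) auto
    \<comment> \<open>\<open>?V\<close> jumps at \<open>0\<close> and \<open>x\<close> only and
      takes at each jump the value to its right, so some later index carries the same value.\<close>
    obtain q where "p < q" "?V q = ?V p"
    proof (cases "p < 0")
      case True
      then obtain q where "p < q" "q < 0" using dense by blast
      then show ?thesis using that True by auto
    next
      case False
      show ?thesis
      proof (cases "p < x")
        case True
        then obtain q where "p < q" "q < x" using dense by blast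
        then show ?thesis using that True False by auto
      next
        case False
        then show ?thesis using that[of "p + 1"] \<open>\<not> p < 0\<close> by auto
      qed
    qed
    then show "?V p \<le> (SUP q\<in>{q. q > p}. ?V q)" by (intro SUP_upper2[of q]) simp_all
  qed
  ultimately show ?thesis by (simp only:)
qed

text \<open>This is the function \<open>t - f\<close>: \<open>t = 0\<close> gives negation, and
  \<open>t = 1\<close> turns a Urysohn function upside down.\<close>

lemma C_exists_reflect:
  assumes f: "f \<in> C"
  shows "\<exists>h\<in>C. (\<forall>p. h (ray_above p) = f (ray_below (t - p))) \<and> (\<forall>q. h (ray_below q) = f (ray_above (t - q)))"
proof (rule C_exists)
  have SUP_reflect: "(SUP q\<in>A. F (t - q)) = (SUP q\<in>{q. t - q \<in> A}. F q)" for F :: "rat \<Rightarrow> 'a" and A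
  proof -
    have "(\<lambda>q. t - q) ` A = {q. t - q \<in> A}"
      by (auto intro!: image_eqI[of x _ "t - x" for x])
    then have "(SUP q\<in>{q. t - q \<in> A}. F q) = (SUP q\<in>(\<lambda>q. t - q) ` A. F q)" by (simp only:)
    then show ?thesis by (simp only: image_image)
  qed
  have reflect: "{q. t - q \<in> {q. q > p}} = {q. q < t - p}" "{q. t - q \<in> {q. q < p}} = {q. q > t - p}" for p
    by auto
  fix p q
  show "inf (f (ray_below (t - p))) (f (ray_above (t - q))) = bot" if "p \<ge> q"
    using C_disjoint[OF f, of "t - p" "t - q"] that by (simp add: inf_commute)
  show "sup (f (ray_below (t - p))) (f (ray_above (t - q))) = top" if "p < q"
    using C_cover[OF f, of "t - q" "t - p"] that by (simp add: sup_commute)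
  show "f (ray_below (t - p)) \<le> (SUP q\<in>{q. q > p}. f (ray_below (t - q)))"
    by (simp only: SUP_reflect[of "\<lambda>x. f (ray_below x)"] reflect C_below[OF f] order_refl)
  show "f (ray_above (t - p)) \<le> (SUP q\<in>{q. q < p}. f (ray_above (t - q)))"
    by (simp only: SUP_reflect[of "\<lambda>x. f (ray_above x)"] reflect C_above[OF f] order_refl)
  show "f (ray_below (t - q)) \<le> f (ray_below (t - p))" "f (ray_above (t - p)) \<le> f (ray_above (t - q))" if "p < q"
    using that by (simp_all add: C_below_mono[OF f] C_above_antimono[OF f])
  show "(SUP p. f (ray_below (t - p))) = top" "(SUP p. f (ray_above (t - p))) = top"
    using SUP_reflect[of "\<lambda>x. f (ray_below x)" UNIV] SUP_reflect[of "\<lambda>x. f (ray_above x)" UNIV]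
    by (simp_all add: C_SUP_below[OF f] C_SUP_above[OF f])
qed

text \<open>Bands of arbitrary length cover because \<open>f\<close> is finite, and each of them is
  exhausted by finitely many bands of width \<open>e\<close>.\<close>

lemma C_partition:
  assumes f: "f \<in> C" and e: "e > 0"
  shows "(SUP r. inf (f (ray_above r)) (f (ray_below (r + e)))) = top"
proof -
  let ?b = "SUP r. inf (f (ray_above r)) (f (ray_below (r + e)))"
  have *: "inf (f (ray_above r)) (f (ray_below s)) \<le> ?b" if "s \<le> r + of_nat n * (e / 2)" for n r s
    using that
  proof (induction n arbitrary: r)
    case 0
    then show ?case by (simp add: C_disjoint[OF f])
  next
    case (Suc n)
    \<comment> \<open>Advancing by \<open>e / 2\<close> rather than \<open>e\<close> leaves the
      overlap that the covering relation requires.\<close>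
    have 1: "sup (f (ray_above (r + e / 2))) (f (ray_below (r + e))) = top"
      by (rule C_cover[OF f]) (use e in simp)
    show ?case
    proof (rule le_if_sup_eq_top_inf_le[OF 1])
      have "s \<le> r + e / 2 + of_nat n * (e / 2)" using Suc.prems by (simp add: field_simps)
      then have "inf (f (ray_above (r + e / 2))) (f (ray_below s)) \<le> ?b" by (rule Suc.IH)
      then show "inf (inf (f (ray_above r)) (f (ray_below s))) (f (ray_above (r + e / 2))) \<le> ?b"
        by (rule order_trans[rotated]) (simp add: le_infI1 le_infI2)
      have "inf (f (ray_above r)) (f (ray_below (r + e))) \<le> ?b" by (rule SUP_upper) simp
      then show "inf (inf (f (ray_above r)) (f (ray_below s))) (f (ray_below (r + e))) \<le> ?b"
        by (rule order_trans[rotated]) (simp add: le_infI1 le_infI2)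
    qed
  qed
  have "inf (SUP r. f (ray_above r)) (SUP s. f (ray_below s)) \<le> ?b"
  proof (rule inf_SUP_SUP_le)
    fix r s
    obtain n where "(s - r) / (e / 2) \<le> of_nat n" using real_arch_simple by blast
    then have "s \<le> r + of_nat n * (e / 2)" using e by (simp add: field_simps)
    then show "inf (f (ray_above r)) (f (ray_below s)) \<le> ?b" by (rule *)
  qed
  then show ?thesis by (simp add: C_SUP_above[OF f] C_SUP_below[OF f] top_unique)
qed

lemma C_exists_add:
  assumes f: "f \<in> C" and g: "g \<in> C"
  shows "\<exists>h\<in>C. (\<forall>p. h (ray_above p) = (SUP r. inf (f (ray_above r)) (g (ray_above (p - r)))))
           \<and> (\<forall>q. h (ray_below q) = (SUP s. inf (f (ray_below s)) (g (ray_below (q - s)))))"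
    (is "\<exists>h\<in>C. (\<forall>p. _ = ?u p) \<and> (\<forall>q. _ = ?l q)")
proof (rule C_exists)
  fix p q :: rat
  show "inf (?u p) (?l q) = bot" if pq: "p \<ge> q"
  proof (rule bot_unique[THEN iffD1], rule inf_SUP_SUP_le)
    fix r s
    \<comment> \<open>Either the bounds on \<open>f\<close> clash, or \<open>r < s\<close> and then
      those on \<open>g\<close> do.\<close>
    have "inf (inf (f (ray_above r)) (f (ray_below s))) (inf (g (ray_above (p - r))) (g (ray_below (q - s)))) = bot"
    proof (cases "s \<le> r")
      case True
      then show ?thesis by (simp add: C_disjoint[OF f])
    next
      case False
      then have "q - s \<le> p - r" using pq by simp
      then show ?thesis by (simp add: C_disjoint[OF g])
    qed
    then show "inf (inf (f (ray_above r)) (g (ray_above (p - r)))) (inf (f (ray_below s)) (g (ray_below (q - s)))) \<le> bot"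
      by (simp only: inf_assoc inf_left_commute order_refl)
  qed
  show "sup (?u p) (?l q) = top" if pq: "p < q"
  proof -
    \<comment> \<open>Cutting \<open>f\<close> into bands narrower than the gap \<open>q - p\<close>
      leaves room for \<open>g\<close> to decide, on each band, between the two sides.\<close>
    obtain e where e: "0 < e" "e < q - p" using pq dense[of 0 "q - p"] by auto
    have "inf (f (ray_above r)) (f (ray_below (r + e))) \<le> sup (?u p) (?l q)" for r
    proof -
      have 1: "sup (g (ray_above (p - r))) (g (ray_below (q - (r + e)))) = top"
        by (rule C_cover[OF g]) (use e in linarith)
      show ?thesis
      proof (rule le_if_sup_eq_top_inf_le[OF 1])
        have "inf (f (ray_above r)) (g (ray_above (p - r))) \<le> ?u p" by (rule SUP_upper) simp
        then show "inf (inf (f (ray_above r)) (f (ray_below (r + e)))) (g (ray_above (p - r))) \<le> sup (?u p) (?l q)"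
          by (intro le_supI1, elim order_trans[rotated]) (simp add: le_infI1)
        have "inf (f (ray_below (r + e))) (g (ray_below (q - (r + e)))) \<le> ?l q" by (rule SUP_upper) simp
        then show "inf (inf (f (ray_above r)) (f (ray_below (r + e)))) (g (ray_below (q - (r + e)))) \<le> sup (?u p) (?l q)"
          by (intro le_supI2, elim order_trans[rotated]) (simp add: le_infI1)
      qed
    qed
    then have "(SUP r. inf (f (ray_above r)) (f (ray_below (r + e)))) \<le> sup (?u p) (?l q)"
      by (rule SUP_least)
    then show ?thesis using C_partition[OF f e(1)] by (simp add: top_unique)
  qed
  show "?u p \<le> (SUP q\<in>{q. q > p}. ?u q)"
  proof (rule SUP_least)
    fix r
    have "inf (f (ray_above r)) (g (ray_above s)) \<le> (SUP q\<in>{q. q > p}. ?u q)" if "s > p - r" for s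
      by (rule SUP_upper2[of "s + r"], use that in simp, rule SUP_upper2[of r]) simp_all
    then have "inf (f (ray_above r)) (SUP s\<in>{s. s > p - r}. g (ray_above s)) \<le> (SUP q\<in>{q. q > p}. ?u q)"
      unfolding inf_SUP_frame by (intro SUP_least) simp
    then show "inf (f (ray_above r)) (g (ray_above (p - r))) \<le> (SUP q\<in>{q. q > p}. ?u q)"
      by (simp only: C_above[OF g])
  qed
  show "?l p \<le> (SUP q\<in>{q. q < p}. ?l q)"
  proof (rule SUP_least)
    fix r
    have "inf (f (ray_below r)) (g (ray_below s)) \<le> (SUP q\<in>{q. q < p}. ?l q)" if "s < p - r" for s
      by (rule SUP_upper2[of "s + r"], use that in simp, rule SUP_upper2[of r]) simp_all
    then have "inf (f (ray_below r)) (SUP s\<in>{s. s < p - r}. g (ray_below s)) \<le> (SUP q\<in>{q. q < p}. ?l q)"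
      unfolding inf_SUP_frame by (intro SUP_least) simp
    then show "inf (f (ray_below r)) (g (ray_below (p - r))) \<le> (SUP q\<in>{q. q < p}. ?l q)"
      by (simp only: C_below[OF g])
  qed
  show "?u q \<le> ?u p" "?l p \<le> ?l q" if "p < q"
    using that by (intro SUP_mono' inf_mono C_above_antimono[OF g] C_below_mono[OF g] order_refl; simp)+
  have "inf (SUP r. f (ray_above r)) (SUP s. g (ray_above s)) \<le> (SUP p. ?u p)"
  proof (rule inf_SUP_SUP_le)
    fix r s show "inf (f (ray_above r)) (g (ray_above s)) \<le> (SUP p. ?u p)"
      by (rule SUP_upper2[of "s + r"], simp, rule SUP_upper2[of r]) simp_all
  qed
  then show "(SUP p. ?u p) = top" by (simp add: C_SUP_above[OF f] C_SUP_above[OF g] top_unique)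
  have "inf (SUP r. f (ray_below r)) (SUP s. g (ray_below s)) \<le> (SUP p. ?l p)"
  proof (rule inf_SUP_SUP_le)
    fix r s show "inf (f (ray_below r)) (g (ray_below s)) \<le> (SUP p. ?l p)"
      by (rule SUP_upper2[of "s + r"], simp, rule SUP_upper2[of r]) simp_all
  qed
  then show "(SUP p. ?l p) = top" by (simp add: C_SUP_below[OF f] C_SUP_below[OF g] top_unique)
qed

text \<open>For real \<open>c\<close> the product \<open>c * of_rat r\<close> need not be a rational
  index, hence the joins over inequalities; density of the rationals supplies indices strictly in
  between.\<close>

lemma C_exists_scale_pos:
  assumes f: "f \<in> C" and c: "(c::real) > 0"
  shows "\<exists>h\<in>C. (\<forall>p. h (ray_above p) = Sup {f (ray_above r) | r. c * of_rat r > of_rat p})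
           \<and> (\<forall>q. h (ray_below q) = Sup {f (ray_below s) | s. c * of_rat s < of_rat q})"
proof -
  let ?u = "\<lambda>p. SUP r\<in>{r. c * of_rat r > of_rat p}. f (ray_above r)"
  let ?l = "\<lambda>q. SUP s\<in>{s. c * of_rat s < of_rat q}. f (ray_below s)"
  have between: "\<exists>r. x < c * of_rat r \<and> c * of_rat r < y" if xy: "x < y" for x y :: real
  proof -
    obtain r where "x / c < of_rat r" "of_rat r < y / c"
      using of_rat_dense[OF divide_strict_right_mono[OF xy c]] by blast
    then show ?thesis using c by (auto simp: field_simps)
  qed
  have less: "r < s" if "c * of_rat r < c * of_rat s" for r s
    using that c by (simp add: of_rat_less)
  have "\<exists>h\<in>C. (\<forall>p. h (ray_above p) = ?u p) \<and> (\<forall>q. h (ray_below q) = ?l q)"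
  proof (rule C_exists)
    fix p q :: rat
    show "inf (?u p) (?l q) = bot" if pq: "p \<ge> q"
    proof (rule bot_unique[THEN iffD1], rule inf_SUP_SUP_le)
      fix r s assume rs: "r \<in> {r. c * of_rat r > of_rat p}" "s \<in> {s. c * of_rat s < of_rat q}"
      have "(of_rat q :: real) \<le> of_rat p" using pq by (simp add: of_rat_less_eq)
      then have "c * of_rat s < c * of_rat r" using rs by simp
      then have "s \<le> r" using less[of s r] by simp
      then show "inf (f (ray_above r)) (f (ray_below s)) \<le> bot" by (simp add: C_disjoint[OF f])
    qed
    show "sup (?u p) (?l q) = top" if pq: "p < q"
    proof -
      obtain r where r: "of_rat p < c * of_rat r" "c * of_rat r < of_rat q"
        using between[of "of_rat p" "of_rat q"] pq by (auto simp: of_rat_less)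
      obtain s where s: "c * of_rat r < c * of_rat s" "c * of_rat s < of_rat q"
        using between[OF r(2)] by blast
      have "sup (f (ray_above r)) (f (ray_below s)) = top" by (rule C_cover[OF f less[OF s(1)]])
      moreover have "sup (f (ray_above r)) (f (ray_below s)) \<le> sup (?u p) (?l q)"
        using r s by (intro sup_mono SUP_upper) auto
      ultimately show ?thesis by (simp add: top_unique)
    qed
    show "?u p \<le> (SUP q\<in>{q. q > p}. ?u q)"
    proof (rule SUP_least)
      fix r assume "r \<in> {r. c * of_rat r > of_rat p}"
      then obtain q where "of_rat p < (of_rat q :: real)" "of_rat q < c * of_rat r"
        using of_rat_dense[of "of_rat p" "c * of_rat r"] by auto
      then show "f (ray_above r) \<le> (SUP q\<in>{q. q > p}. ?u q)"
        by (intro SUP_upper2[of q] SUP_upper) (auto simp: of_rat_less)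
    qed
    show "?l p \<le> (SUP q\<in>{q. q < p}. ?l q)"
    proof (rule SUP_least)
      fix r assume "r \<in> {r. c * of_rat r < of_rat p}"
      then obtain q where "c * of_rat r < of_rat q" "of_rat q < (of_rat p :: real)"
        using of_rat_dense[of "c * of_rat r" "of_rat p"] by auto
      then show "f (ray_below r) \<le> (SUP q\<in>{q. q < p}. ?l q)"
        by (intro SUP_upper2[of q] SUP_upper) (auto simp: of_rat_less)
    qed
    show "?u q \<le> ?u p" "?l p \<le> ?l q" if "p < q"
    proof -
      have "(of_rat p :: real) < of_rat q" using that by (simp add: of_rat_less)
      then show "?u q \<le> ?u p" "?l p \<le> ?l q" by (auto intro!: SUP_subset_mono)
    qed
    have "(SUP r. f (ray_above r)) \<le> (SUP p. ?u p)"
    proof (rule SUP_least)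
      fix r
      obtain q where "of_rat q < c * of_rat r" using of_rat_dense[of "c * of_rat r - 1" "c * of_rat r"] by auto
      then show "f (ray_above r) \<le> (SUP p. ?u p)" by (intro SUP_upper2[of q] SUP_upper) auto
    qed
    then show "(SUP p. ?u p) = top" by (simp add: C_SUP_above[OF f] top_unique)
    have "(SUP r. f (ray_below r)) \<le> (SUP p. ?l p)"
    proof (rule SUP_least)
      fix r
      obtain q where "c * of_rat r < of_rat q" using of_rat_dense[of "c * of_rat r" "c * of_rat r + 1"] by auto
      then show "f (ray_below r) \<le> (SUP p. ?l p)" by (intro SUP_upper2[of q] SUP_upper) auto
    qed
    then show "(SUP p. ?l p) = top" by (simp add: C_SUP_below[OF f] top_unique)
  qed
  then show ?thesis by (simp add: setcompr_eq_image)
qed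

lemma C_exists_join:
  assumes f: "f \<in> C" and g: "g \<in> C"
  shows "\<exists>h\<in>C. \<forall>p. h (ray_above p) = sup (f (ray_above p)) (g (ray_above p))"
proof -
  let ?V = "\<lambda>p. sup (f (ray_above p)) (g (ray_above p))"
  have "\<exists>h\<in>C. \<forall>p. h (ray_above p) = (SUP q\<in>{q. q > p}. ?V q)"
  proof (rule C_exists_above)
    show "?V q \<prec> ?V p" if "p < q" for p q
      using that by (intro rather_below_sup C_above_rather_below f g)
    have "(SUP p. f (ray_above p)) \<le> (SUP p. ?V p)" by (intro SUP_mono') simp
    then show "(SUP p. ?V p) = top" by (simp add: C_SUP_above[OF f] top_unique)
    \<comment> \<open>A bound \<open>i\<close> on \<open>f\<close> and a bound \<open>j\<close> on
      \<open>g\<close> combine to the bound \<open>max i j\<close> on the join.\<close>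
    have "inf (SUP p. pcomp (f (ray_above p))) (SUP p. pcomp (g (ray_above p))) \<le> (SUP p. pcomp (?V p))"
    proof (rule inf_SUP_SUP_le)
      fix i j :: rat
      have "inf (pcomp (f (ray_above i))) (pcomp (g (ray_above j))) \<le> pcomp (?V (max i j))"
        unfolding pcomp_sup by (intro inf_mono pcomp_antimono C_above_antimono f g) simp_all
      then show "inf (pcomp (f (ray_above i))) (pcomp (g (ray_above j))) \<le> (SUP p. pcomp (?V p))"
        by (rule SUP_upper2[OF UNIV_I])
    qed
    then show "(SUP p. pcomp (?V p)) = top"
      by (simp add: C_SUP_pcomp_above[OF f] C_SUP_pcomp_above[OF g] top_unique)
  qed
  moreover have "(SUP q\<in>{q. q > p}. ?V q) = ?V p" for p
    by (simp only: complete_lattice_class.SUP_sup_distrib[symmetric] C_above[OF f] C_above[OF g])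
  ultimately show ?thesis by simp
qed

lemma C_exists_meet:
  assumes f: "f \<in> C" and g: "g \<in> C"
  shows "\<exists>h\<in>C. \<forall>p. h (ray_above p) = inf (f (ray_above p)) (g (ray_above p))"
proof -
  let ?V = "\<lambda>p. inf (f (ray_above p)) (g (ray_above p))"
  have V_le: "inf (f (ray_above i)) (g (ray_above j)) \<le> ?V (min i j)" for i j
    by (intro inf_mono C_above_antimono f g) simp_all
  have "\<exists>h\<in>C. \<forall>p. h (ray_above p) = (SUP q\<in>{q. q > p}. ?V q)"
  proof (rule C_exists_above)
    show "?V q \<prec> ?V p" if "p < q" for p q
    proof -
      have "pcomp (f (ray_above q)) \<le> pcomp (?V q)" "pcomp (g (ray_above q)) \<le> pcomp (?V q)"
        by (simp_all add: pcomp_antimono)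
      then have "sup (pcomp (?V q)) (f (ray_above p)) = top" "sup (pcomp (?V q)) (g (ray_above p)) = top"
        using C_above_rather_below[OF f that] C_above_rather_below[OF g that]
        unfolding rather_below_def by (metis sup_mono order_refl top_le)+
      then show ?thesis by (simp add: rather_below_def sup_inf_distrib1)
    qed
    have "inf (SUP p. f (ray_above p)) (SUP p. g (ray_above p)) \<le> (SUP p. ?V p)"
      by (rule inf_SUP_SUP_le) (rule order_trans[OF V_le], rule SUP_upper, simp)
    then show "(SUP p. ?V p) = top" by (simp add: C_SUP_above[OF f] C_SUP_above[OF g] top_unique)
    have "(SUP p. pcomp (f (ray_above p))) \<le> (SUP p. pcomp (?V p))"
      by (intro SUP_mono' pcomp_antimono) simp
    then show "(SUP p. pcomp (?V p)) = top" by (simp add: C_SUP_pcomp_above[OF f] top_unique)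
  qed
  moreover have "(SUP q\<in>{q. q > p}. ?V q) = ?V p" for p
  proof (rule antisym)
    show "(SUP q\<in>{q. q > p}. ?V q) \<le> ?V p"
      by (intro SUP_least inf_mono C_above_antimono f g) simp_all
    have "inf (SUP q\<in>{q. q > p}. f (ray_above q)) (SUP q\<in>{q. q > p}. g (ray_above q)) \<le> (SUP q\<in>{q. q > p}. ?V q)"
      by (rule inf_SUP_SUP_le) (rule order_trans[OF V_le], rule SUP_upper, simp)
    then show "?V p \<le> (SUP q\<in>{q. q > p}. ?V q)" by (simp only: C_above[OF f] C_above[OF g])
  qed
  ultimately show ?thesis by simp
qed


section \<open>The Riesz space operations\<close>

lemma C_zero:
  shows "(C_zero :: ir_frame \<Rightarrow> 'a::frame) \<in> C"
    and "C_zero (ray_above p) = (if p < 0 then top else bot :: 'a)"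
    and "C_zero (ray_below q) = (if 0 < q then top else bot :: 'a)"
proof -
  obtain h :: "ir_frame \<Rightarrow> 'a" where h: "h \<in> C"
    and above: "\<And>p. h (ray_above p) = (if p < 0 then top else bot)"
    using C_exists_indicator[OF complemented_bot order_refl] by (metis (full_types))
  have below: "h (ray_below q) = (if 0 < q then top else bot)" for q
  proof (cases "0 < q")
    case True
    then show ?thesis
      by (auto simp: C_below_eq[OF h] above intro!: top_le intro: SUP_upper2[of 0])
  next
    case False
    then show ?thesis
      by (auto simp: C_below_eq[OF h] above intro!: bot_unique[THEN iffD1] SUP_least)
  qed
  have zero: "C_zero = h"
    unfolding C_zero_def by (rule the_equality) (auto simp: h above below intro: C_eqI[OF _ h])
  show "(C_zero :: ir_frame \<Rightarrow> 'a) \<in> C"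
    and "C_zero (ray_above p) = (if p < 0 then top else bot :: 'a)"
    and "C_zero (ray_below q) = (if 0 < q then top else bot :: 'a)"
    unfolding zero by (fact h above below)+
qed

text \<open>Rules of this shape handle the definite descriptions behind the operations: by
  \<open>C_eqI\<close> ray values identify a function, so later identities are checked on
  rays.\<close>

lemma C_zero_eqI: "h \<in> C \<Longrightarrow> (\<And>p. h (ray_above p) = (if p < 0 then top else bot)) \<Longrightarrow> C_zero = h"
  by (rule C_eqI) (simp_all add: C_zero)

lemma C_add_eqI:
  assumes h: "h \<in> C" and "\<And>p. h (ray_above p) = (SUP r. inf (f (ray_above r)) (g (ray_above (p - r))))"
    and "\<And>q. h (ray_below q) = (SUP s. inf (f (ray_below s)) (g (ray_below (q - s))))"
  shows "C_add f g = h"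
  unfolding C_add_def by (rule the_equality) (auto simp: assms intro: C_eqI[OF _ h])

lemma C_add:
  assumes "f \<in> C" "g \<in> C"
  shows "C_add f g \<in> C"
    and "C_add f g (ray_above p) = (SUP r. inf (f (ray_above r)) (g (ray_above (p - r))))"
    and "C_add f g (ray_below q) = (SUP s. inf (f (ray_below s)) (g (ray_below (q - s))))"
proof -
  obtain h where "h \<in> C" "\<And>p. h (ray_above p) = (SUP r. inf (f (ray_above r)) (g (ray_above (p - r))))"
    "\<And>q. h (ray_below q) = (SUP s. inf (f (ray_below s)) (g (ray_below (q - s))))"
    using C_exists_add[OF assms] by blast
  moreover from this have "C_add f g = h" by (rule C_add_eqI)
  ultimately show "C_add f g \<in> C"
    "C_add f g (ray_above p) = (SUP r. inf (f (ray_above r)) (g (ray_above (p - r))))"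
    "C_add f g (ray_below q) = (SUP s. inf (f (ray_below s)) (g (ray_below (q - s))))"
    by simp_all
qed

lemma C_uminus_eqI:
  assumes h: "h \<in> C" and "\<And>p. h (ray_above p) = f (ray_below (- p))"
    and "\<And>q. h (ray_below q) = f (ray_above (- q))"
  shows "C_uminus f = h"
  unfolding C_uminus_def by (rule the_equality) (auto simp: assms intro: C_eqI[OF _ h])

lemma C_uminus:
  assumes "f \<in> C"
  shows "C_uminus f \<in> C" and "C_uminus f (ray_above p) = f (ray_below (- p))"
    and "C_uminus f (ray_below q) = f (ray_above (- q))"
proof -
  obtain h where "h \<in> C" "\<And>p. h (ray_above p) = f (ray_below (- p))"
    "\<And>q. h (ray_below q) = f (ray_above (- q))"
    using C_exists_reflect[OF assms, of 0] by auto
  moreover from this have "C_uminus f = h" by (rule C_uminus_eqI)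
  ultimately show "C_uminus f \<in> C" "C_uminus f (ray_above p) = f (ray_below (- p))"
    "C_uminus f (ray_below q) = f (ray_above (- q))"
    by simp_all
qed

lemma C_scale_pos_eqI:
  assumes h: "h \<in> C" and "\<And>p. h (ray_above p) = Sup {f (ray_above r) | r. c * of_rat r > of_rat p}"
    and "\<And>q. h (ray_below q) = Sup {f (ray_below s) | s. c * of_rat s < of_rat q}"
  shows "C_scale_pos c f = h"
  unfolding C_scale_pos_def by (rule the_equality) (auto simp: assms intro: C_eqI[OF _ h])

lemma C_scale_pos:
  assumes "f \<in> C" "c > 0"
  shows "C_scale_pos c f \<in> C"
    and "C_scale_pos c f (ray_above p) = Sup {f (ray_above r) | r. c * of_rat r > of_rat p}"
    and "C_scale_pos c f (ray_below q) = Sup {f (ray_below s) | s. c * of_rat s < of_rat q}"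
proof -
  obtain h where "h \<in> C" "\<And>p. h (ray_above p) = Sup {f (ray_above r) | r. c * of_rat r > of_rat p}"
    "\<And>q. h (ray_below q) = Sup {f (ray_below s) | s. c * of_rat s < of_rat q}"
    using C_exists_scale_pos[OF assms] by blast
  moreover from this have "C_scale_pos c f = h" by (rule C_scale_pos_eqI)
  ultimately show "C_scale_pos c f \<in> C"
    "C_scale_pos c f (ray_above p) = Sup {f (ray_above r) | r. c * of_rat r > of_rat p}"
    "C_scale_pos c f (ray_below q) = Sup {f (ray_below s) | s. c * of_rat s < of_rat q}"
    by simp_all
qed

lemma C_join_eqI:
  assumes h: "h \<in> C" and "\<And>p. h (ray_above p) = sup (f (ray_above p)) (g (ray_above p))"
  shows "C_join f g = h"
  unfolding C_join_def by (rule the_equality) (auto simp: assms intro: C_eqI[OF _ h])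

lemma C_join:
  assumes "f \<in> C" "g \<in> C"
  shows "C_join f g \<in> C" and "C_join f g (ray_above p) = sup (f (ray_above p)) (g (ray_above p))"
proof -
  obtain h where "h \<in> C" "\<And>p. h (ray_above p) = sup (f (ray_above p)) (g (ray_above p))"
    using C_exists_join[OF assms] by blast
  moreover from this have "C_join f g = h" by (rule C_join_eqI)
  ultimately show "C_join f g \<in> C" "C_join f g (ray_above p) = sup (f (ray_above p)) (g (ray_above p))"
    by simp_all
qed

lemma C_meet_eqI:
  assumes h: "h \<in> C" and "\<And>p. h (ray_above p) = inf (f (ray_above p)) (g (ray_above p))"
  shows "C_meet f g = h"
  unfolding C_meet_def by (rule the_equality) (auto simp: assms intro: C_eqI[OF _ h])

lemma C_meet:
  assumes "f \<in> C" "g \<in> C"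
  shows "C_meet f g \<in> C" and "C_meet f g (ray_above p) = inf (f (ray_above p)) (g (ray_above p))"
proof -
  obtain h where "h \<in> C" "\<And>p. h (ray_above p) = inf (f (ray_above p)) (g (ray_above p))"
    using C_exists_meet[OF assms] by blast
  moreover from this have "C_meet f g = h" by (rule C_meet_eqI)
  ultimately show "C_meet f g \<in> C" "C_meet f g (ray_above p) = inf (f (ray_above p)) (g (ray_above p))"
    by simp_all
qed

text \<open>\<open>riesz_iso\<close> speaks of the lattice operations and not of the order; this
  recovers the order from the meet.\<close>

lemma C_le_iff_meet: "f \<in> C \<Longrightarrow> g \<in> C \<Longrightarrow> C_le f g \<longleftrightarrow> C_meet f g = f"
proof
  assume "f \<in> C" "g \<in> C"
  show "C_le f g \<Longrightarrow> C_meet f g = f"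
    by (rule C_meet_eqI) (simp_all add: \<open>f \<in> C\<close> C_le_def inf.absorb1)
  assume "C_meet f g = f"
  then show "C_le f g"
    using C_meet(2)[OF \<open>f \<in> C\<close> \<open>g \<in> C\<close>] by (auto simp: C_le_def inf.absorb_iff1)
qed

section \<open>Transport along frame homomorphisms and Riesz isomorphisms\<close>

lemma frame_hom_top: "frame_hom k \<Longrightarrow> k top = top"
  and frame_hom_inf: "frame_hom k \<Longrightarrow> k (inf a b) = inf (k a) (k b)"
  by (simp_all add: frame_hom_def)

lemma frame_hom_bot: "frame_hom k \<Longrightarrow> k bot = bot"
  using frame_hom_Sup[of k "{}"] by simp

lemma frame_hom_sup: "frame_hom k \<Longrightarrow> k (sup a b) = sup (k a) (k b)"
  using frame_hom_Sup[of k "{a, b}"] by simp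

lemma comp_in_C:
  assumes k: "frame_hom k" and f: "f \<in> C"
  shows "k \<circ> f \<in> C"
proof -
  have "frame_hom f" using f by (simp add: C_def IC_def)
  then have "frame_hom (k \<circ> f)" using k by (simp add: frame_hom_def image_comp)
  moreover have "(SUP p. k (f (ray_above p))) = top" "(SUP p. k (f (ray_below p))) = top"
    using frame_hom_SUP[OF k, of "\<lambda>p. f (ray_above p)" UNIV] frame_hom_SUP[OF k, of "\<lambda>p. f (ray_below p)" UNIV]
    by (simp_all add: C_SUP_above[OF f] C_SUP_below[OF f] frame_hom_top[OF k])
  moreover have "sup (k (f (ray_above p))) (k (f (ray_below q))) = top" if "p < q" for p q
    using C_cover[OF f that] by (simp add: frame_hom_top[OF k] flip: frame_hom_sup[OF k])
  ultimately show ?thesis by (simp add: C_def IC_def)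
qed

lemma comp_C_zero: "frame_hom k \<Longrightarrow> k \<circ> C_zero = C_zero"
  by (rule C_zero_eqI[symmetric]) (simp_all add: comp_in_C C_zero frame_hom_top frame_hom_bot)

lemma comp_C_scale_pos:
  assumes k: "frame_hom k" and f: "f \<in> C" and c: "c > 0"
  shows "C_scale_pos c (k \<circ> f) = k \<circ> C_scale_pos c f"
  by (rule C_scale_pos_eqI)
    (auto simp: comp_in_C[OF k] C_scale_pos[OF f c] frame_hom_Sup[OF k] intro!: arg_cong[of _ _ Sup])

lemma comp_C_uminus: "frame_hom k \<Longrightarrow> f \<in> C \<Longrightarrow> C_uminus (k \<circ> f) = k \<circ> C_uminus f"
  by (rule C_uminus_eqI) (simp_all add: comp_in_C C_uminus)

text \<open>The operations are built from joins and finite meets of rays, which a frame homomorphism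
  preserves; bijectivity is the only real condition.\<close>

lemma riesz_iso_comp:
  assumes k: "frame_hom k" and "bij_betw ((\<circ>) k) C C"
  shows "riesz_iso C_riesz C_riesz ((\<circ>) k)"
proof -
  have "k \<circ> C_add f g = C_add (k \<circ> f) (k \<circ> g)" if "f \<in> C" "g \<in> C" for f g
    by (rule C_add_eqI[symmetric])
      (simp_all add: comp_in_C[OF k] C_add[OF that] frame_hom_SUP[OF k] frame_hom_inf[OF k])
  moreover have "k \<circ> C_join f g = C_join (k \<circ> f) (k \<circ> g)" if "f \<in> C" "g \<in> C" for f g
    by (rule C_join_eqI[symmetric]) (simp_all add: comp_in_C[OF k] C_join[OF that] frame_hom_sup[OF k])
  moreover have "k \<circ> C_meet f g = C_meet (k \<circ> f) (k \<circ> g)" if "f \<in> C" "g \<in> C" for f g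
    by (rule C_meet_eqI[symmetric]) (simp_all add: comp_in_C[OF k] C_meet[OF that] frame_hom_inf[OF k])
  moreover have "k \<circ> C_scale c f = C_scale c (k \<circ> f)" if "f \<in> C" for c f
    using that by (simp add: C_scale_def comp_C_zero[OF k] comp_C_scale_pos[OF k] comp_C_uminus[OF k] C_scale_pos(1))
  ultimately show ?thesis using assms by (simp add: riesz_iso_def C_riesz_def)
qed

lemma universally_complete_riesz_iso:
  fixes \<phi> :: "(ir_frame \<Rightarrow> 'a::frame) \<Rightarrow> (ir_frame \<Rightarrow> 'b::frame)"
  assumes iso: "riesz_iso C_riesz C_riesz \<phi>"
    and complete: "universally_complete (C_riesz :: (ir_frame \<Rightarrow> 'b) riesz)"
  shows "universally_complete (C_riesz :: (ir_frame \<Rightarrow> 'a) riesz)"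
proof -
  have bij: "bij_betw \<phi> C C" and meet: "\<And>f g. f \<in> C \<Longrightarrow> g \<in> C \<Longrightarrow> \<phi> (C_meet f g) = C_meet (\<phi> f) (\<phi> g)"
    and scale: "\<And>c f. f \<in> C \<Longrightarrow> \<phi> (C_scale c f) = C_scale c (\<phi> f)"
    using iso by (auto simp: riesz_iso_def C_riesz_def)
  have in_C: "\<phi> f \<in> C" if "f \<in> C" for f using bij that by (auto simp: bij_betw_def)
  have inj: "\<phi> f = \<phi> g \<longleftrightarrow> f = g" if "f \<in> C" "g \<in> C" for f g
    using bij that by (auto simp: bij_betw_def inj_on_eq_iff)
  have le: "C_le (\<phi> f) (\<phi> g) \<longleftrightarrow> C_le f g" if "f \<in> C" "g \<in> C" for f g
    using that by (simp add: C_le_iff_meet in_C inj C_meet(1) flip: meet)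
  \<comment> \<open>An isomorphism is not asked to preserve zero, but multiplication by
    \<open>0\<close> produces it.\<close>
  have zero: "\<phi> C_zero = C_zero"
    using scale[OF C_zero(1), of 0] by (simp add: C_scale_def)
  have sup: "\<exists>x. is_supremum C_riesz S x" if S: "S \<subseteq> C" and x: "is_supremum C_riesz (\<phi> ` S) x" for S x
  proof -
    have "x \<in> C" using x by (simp add: is_supremum_def C_riesz_def)
    then obtain y where y: "y \<in> C" "x = \<phi> y" using bij by (auto simp: bij_betw_def)
    have sub: "\<And>s. s \<in> S \<Longrightarrow> s \<in> C" using S by blast
    have "C_le s y" if "s \<in> S" for s
      using x that y le[OF sub[OF that] y(1)] by (auto simp: is_supremum_def C_riesz_def)
    moreover have "C_le y z" if z: "z \<in> C" "\<And>s. s \<in> S \<Longrightarrow> C_le s z" for z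
    proof -
      have "\<forall>t\<in>\<phi> ` S. C_le t (\<phi> z)" using z le[OF sub z(1)] by auto
      then have "C_le (\<phi> y) (\<phi> z)"
        using x y in_C[OF z(1)] by (simp add: is_supremum_def C_riesz_def)
      then show ?thesis using le[OF y(1) z(1)] by simp
    qed
    ultimately show ?thesis using y(1) by (auto simp: is_supremum_def C_riesz_def)
  qed
  have "dedekind_complete (C_riesz :: (ir_frame \<Rightarrow> 'a) riesz)"
    unfolding dedekind_complete_def
  proof (intro allI impI, elim conjE bexE)
    fix S :: "(ir_frame \<Rightarrow> 'a) set" and y
    assume S: "S \<subseteq> carrier C_riesz" "S \<noteq> {}" and y: "y \<in> carrier C_riesz" "\<forall>s\<in>S. le C_riesz s y"
    have sub: "S \<subseteq> C" and yC: "y \<in> C" using S y by (simp_all add: C_riesz_def)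
    have "\<forall>t\<in>\<phi> ` S. C_le t (\<phi> y)" using y le sub yC by (auto simp: C_riesz_def)
    then have "\<exists>y\<in>carrier C_riesz. \<forall>t\<in>\<phi> ` S. le C_riesz t y"
      using in_C[OF yC] by (auto simp: C_riesz_def)
    moreover have "\<phi> ` S \<subseteq> carrier C_riesz" using sub in_C by (auto simp: C_riesz_def)
    ultimately have "\<exists>x. is_supremum C_riesz (\<phi> ` S) x"
      using complete S(2) unfolding universally_complete_def dedekind_complete_def by blast
    then show "\<exists>x. is_supremum C_riesz S x" using sup[OF sub] by blast
  qed
  moreover have "laterally_complete (C_riesz :: (ir_frame \<Rightarrow> 'a) riesz)"
    unfolding laterally_complete_def
  proof (intro allI impI, elim conjE)
    fix S :: "(ir_frame \<Rightarrow> 'a) set"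
    assume S: "S \<subseteq> carrier C_riesz" "S \<noteq> {}" "\<forall>f\<in>S. le C_riesz (zero C_riesz) f"
      "\<forall>f\<in>S. \<forall>g\<in>S. f \<noteq> g \<longrightarrow> meet C_riesz f g = zero C_riesz"
    have sub: "S \<subseteq> C" using S by (simp add: C_riesz_def)
    have pos: "\<forall>t\<in>\<phi> ` S. C_le C_zero t"
      using S(3) le[OF C_zero(1)] sub by (auto simp: C_riesz_def zero)
    have disj: "\<forall>s\<in>\<phi> ` S. \<forall>t\<in>\<phi> ` S. s \<noteq> t \<longrightarrow> C_meet s t = C_zero"
    proof (intro ballI impI, elim imageE)
      fix s t f g assume *: "s \<noteq> t" "s = \<phi> f" "f \<in> S" "t = \<phi> g" "g \<in> S"
      then have "C_meet f g = C_zero" using S(4) by (auto simp: C_riesz_def)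
      moreover have "f \<in> C" "g \<in> C" using * sub by auto
      ultimately show "C_meet s t = C_zero" using meet[of f g] by (simp add: *(2,4) zero)
    qed
    have "\<phi> ` S \<subseteq> C" using sub in_C by auto
    then have "\<exists>x. is_supremum C_riesz (\<phi> ` S) x"
      using complete S(2) pos disj
      unfolding universally_complete_def laterally_complete_def by (simp add: C_riesz_def)
    then show "\<exists>x. is_supremum C_riesz S x" using sup[OF sub] by blast
  qed
  ultimately show ?thesis by (simp add: universally_complete_def)
qed


section \<open>Extremally disconnected P-frames\<close>

text \<open>The join of an element and its pseudocomplement is dense in the original frame, and
  joins in the Booleanization are regularised, so it becomes top there.\<close>

lemma complemented_booleanization: "complemented (b :: 'a::frame booleanization)"
proof -
  have "\<exists>c. sup b c = top \<and> inf b c = bot"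
  proof transfer
    fix b :: 'a
    show "\<exists>c\<in>{a. pcomp (pcomp a) = a}. pcomp (pcomp (sup b c)) = top \<and> inf b c = bot"
      by (rule bexI[of _ "pcomp b"]) (simp_all add: pcomp_sup pcomp_pcomp_pcomp)
  qed
  then show ?thesis using complementedI by blast
qed

lemma booleanization_P_frame:
  "extremally_disconnected TYPE('a::frame booleanization)" "P_frame TYPE('a booleanization)"
  by (simp_all add: extremally_disconnected_def P_frame_def complemented_booleanization
      complemented_booleanization[unfolded complemented_def])

text \<open>The witness takes the value \<open>1 / (n + 1)\<close> on the part of \<open>b n\<close> outside the earlier \<open>b m\<close>.\<close>

lemma cozero_SUP_complemented:
  fixes b :: "nat \<Rightarrow> 'a::frame"
  assumes b: "\<And>n. complemented (b n)"
  shows "cozero (SUP n. b n)"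
proof -
  let ?N = "\<lambda>p. {n. inverse (of_nat (Suc n)) > (p :: rat)}"
  let ?V = "\<lambda>p. if p < 0 then top else SUP n\<in>?N p. b n"
  \<comment> \<open>Only finitely many pieces reach a positive height \<open>q\<close>, which makes
    the ray at \<open>q\<close> complemented although the join of all pieces need not be.\<close>
  have fin: "finite (?N q)" if q: "q > 0" for q
  proof -
    obtain N where N: "inverse (of_nat (Suc N)) < q" using reals_Archimedean[OF q] by blast
    have "?N q \<subseteq> {..<N}"
    proof
      fix n assume "n \<in> ?N q"
      then have "q < inverse (of_nat (Suc n))" by (rule CollectD)
      with N have "inverse (of_nat (Suc N)) < (inverse (of_nat (Suc n)) :: rat)" by (rule less_trans)
      then have "(of_nat (Suc n) :: rat) < of_nat (Suc N)" by (rule inverse_less_imp_less) simp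
      then show "n \<in> {..<N}" by simp
    qed
    then show ?thesis by (rule finite_subset) simp
  qed
  have "\<exists>f\<in>C. \<forall>p. f (ray_above p) = (SUP q\<in>{q. q > p}. ?V q)"
  proof (rule C_exists_above)
    fix p q :: rat assume pq: "p < q"
    show "?V q \<prec> ?V p"
    proof (cases "p < 0")
      case False
      then have "complemented (SUP n\<in>?N q. b n)"
        using pq by (intro complemented_finite_SUP fin b) simp
      moreover have "(SUP n\<in>?N q. b n) \<le> (SUP n\<in>?N p. b n)"
        using pq by (intro SUP_subset_mono) auto
      ultimately have "(SUP n\<in>?N q. b n) \<prec> (SUP n\<in>?N p. b n)" by (rule complemented_rather_below)
      then show ?thesis using False pq by simp
    qed simp
  next
    show "(SUP p. ?V p) = top" by (rule top_le, rule SUP_upper2[of "-1"]) simp_all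
    have "?N 1 = {}"
    proof -
      have "inverse (of_nat (Suc n)) \<le> (1 :: rat)" for n
        using inverse_le_1_iff[of "of_nat (Suc n) :: rat"] by simp
      then show ?thesis by (auto simp: not_less)
    qed
    then have "?V 1 = bot" by (simp del: of_nat_Suc)
    then have "pcomp (?V 1) = top" by (simp only: pcomp_bot)
    then show "(SUP p. pcomp (?V p)) = top" by (intro top_le SUP_upper2[of 1]) (simp_all only: UNIV_I order_refl)
  qed
  then obtain f where f: "f \<in> C" and above: "\<And>p. f (ray_above p) = (SUP q\<in>{q. q > p}. ?V q)"
    by blast
  have below0: "f (ray_below 0) = bot"
  proof -
    have "f (ray_above r) = top" if "r < 0" for r
    proof -
      obtain q where "r < q" "q < 0" using \<open>r < 0\<close> dense by blast
      then show ?thesis unfolding above by (intro top_le SUP_upper2[of q]) simp_all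
    qed
    then show ?thesis
      unfolding C_below_eq[OF f] by (intro bot_unique[THEN iffD1] SUP_least) simp
  qed
  have above0: "f (ray_above 0) = (SUP n. b n)"
  proof (rule antisym)
    show "f (ray_above 0) \<le> (SUP n. b n)"
      unfolding above by (rule SUP_least) (auto intro!: SUP_subset_mono)
    show "(SUP n. b n) \<le> f (ray_above 0)"
    proof (rule SUP_least)
      fix n
      obtain q :: rat where "0 < q" "q < inverse (of_nat (Suc n))"
        using dense[of 0 "inverse (of_nat (Suc n)) :: rat"] by auto
      then show "b n \<le> f (ray_above 0)"
        unfolding above by (intro SUP_upper2[of q]) (auto simp del: of_nat_Suc intro: SUP_upper)
    qed
  qed
  show ?thesis
    unfolding cozero_def by (rule bexI[OF _ f]) (simp add: below0 above0)
qed

text \<open>The form in which the P-frame condition is applied; a countable index type admits joins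
  over rational rays.\<close>

lemma P_frame_complemented_SUP:
  fixes b :: "'i::countable \<Rightarrow> 'a::frame"
  assumes P: "P_frame TYPE('a)" and b: "\<And>i. complemented (b i)"
  shows "complemented (SUP i. b i)"
proof -
  have "(SUP n. b (from_nat n)) = (SUP i\<in>range (from_nat :: nat \<Rightarrow> 'i). b i)" by (simp only: image_image)
  then have "(SUP i. b i) = (SUP n. b (from_nat n))" by (simp only: surj_from_nat)
  then show ?thesis using P b cozero_SUP_complemented[of "\<lambda>n. b (from_nat n)"] by (simp add: P_frame_def)
qed

text \<open>The parts where the absolute value of \<open>f\<close> exceeds
  \<open>1 / (n + 1)\<close> exhaust the cozero element and lie \<open>\<prec>\<close> below it.
  They may thus be replaced by their double pseudocomplements, which are complemented here.\<close>

lemma cozero_eq_SUP_complemented: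
  fixes a :: "'a::frame"
  assumes ED: "extremally_disconnected TYPE('a)" and "cozero a"
  shows "\<exists>b :: nat \<Rightarrow> 'a. (\<forall>n. complemented (b n)) \<and> a = (SUP n. b n)"
proof -
  obtain f where f: "f \<in> C" and a: "a = sup (f (ray_below 0)) (f (ray_above 0))"
    using assms(2) by (auto simp: cozero_def)
  define e :: "nat \<Rightarrow> rat" where "e n = inverse (of_nat (Suc n))" for n
  have e: "e n > 0" for n by (simp add: e_def)
  let ?c = "\<lambda>n. sup (f (ray_below (- e n))) (f (ray_above (e n)))"
  have "pcomp (pcomp (?c n)) \<le> a" for n
    unfolding a using e[of n]
    by (intro rather_below_pcomp_pcomp_le rather_below_sup C_below_rather_below[OF f] C_above_rather_below[OF f]) simp_all
  moreover have "a \<le> (SUP n. pcomp (pcomp (?c n)))"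
  proof -
    have c: "x \<le> (SUP n. pcomp (pcomp (?c n)))" if "x \<le> ?c n" for x n
      using that by (intro SUP_upper2[of n]) (simp_all add: order_trans[OF _ le_pcomp_pcomp])
    have "f (ray_above q) \<le> (SUP n. pcomp (pcomp (?c n)))" if q: "q > 0" for q
    proof -
      obtain n where "e n < q" using reals_Archimedean[OF q] by (auto simp: e_def)
      then have "f (ray_above q) \<le> ?c n" by (intro le_supI2 C_above_antimono f) simp
      then show ?thesis by (rule c)
    qed
    moreover have "f (ray_below q) \<le> (SUP n. pcomp (pcomp (?c n)))" if q: "q < 0" for q
    proof -
      obtain n where "e n < - q" using reals_Archimedean[of "- q"] q by (auto simp: e_def)
      then have "f (ray_below q) \<le> ?c n" by (intro le_supI1 C_below_mono f) simp
      then show ?thesis by (rule c)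
    qed
    ultimately show ?thesis
      unfolding a by (subst C_below[OF f, symmetric], subst C_above[OF f, symmetric])
        (auto intro!: SUP_least)
  qed
  ultimately have "a = (SUP n. pcomp (pcomp (?c n)))" by (intro antisym SUP_least)
  then show ?thesis using extremally_disconnected_complemented[OF ED]
    by (intro exI[of _ "\<lambda>n. pcomp (pcomp (?c n))"]) simp
qed

text \<open>\<open>bounded\<close> asks for local boundedness only, so order-bounded sets and
  disjoint families are treated alike. Pointwise joins of rays need not decrease for
  \<open>\<prec>\<close> and are therefore regularised; an upper bound \<open>g\<close> absorbs the
  regularisation after a shift of index.\<close>

lemma C_exists_supremum:
  fixes S :: "(ir_frame \<Rightarrow> 'a::frame) set"
  assumes ED: "extremally_disconnected TYPE('a)" and S: "S \<subseteq> C" "S \<noteq> {}"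
    and bounded: "(SUP p. pcomp (SUP f\<in>S. f (ray_above p))) = top"
  shows "\<exists>h. is_supremum C_riesz S h"
proof -
  let ?T = "\<lambda>p. SUP f\<in>S. f (ray_above p)"
  let ?V = "\<lambda>p. pcomp (pcomp (?T p))"
  have inC: "\<And>f. f \<in> S \<Longrightarrow> f \<in> C" using S by blast
  have upper: "f (ray_above p) \<le> ?V p" if "f \<in> S" for f and p :: rat
    using that by (intro order_trans[OF _ le_pcomp_pcomp] SUP_upper)
  have "\<exists>h\<in>C. \<forall>p. h (ray_above p) = (SUP q\<in>{q. q > p}. ?V q)"
  proof (rule C_exists_above)
    show "?V q \<prec> ?V p" if "p < q" for p q
      using that inC by (intro complemented_rather_below extremally_disconnected_complemented[OF ED]
          pcomp_pcomp_mono SUP_mono) (auto intro!: bexI[rotated] C_above_antimono)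
    obtain f where f: "f \<in> S" using S by blast
    have "(SUP p. f (ray_above p)) \<le> (SUP p. ?V p)" by (intro SUP_mono' upper f)
    then show "(SUP p. ?V p) = top" by (simp add: C_SUP_above[OF inC[OF f]] top_unique)
    show "(SUP p. pcomp (?V p)) = top" using bounded by (simp add: pcomp_pcomp_pcomp)
  qed
  then obtain h where h: "h \<in> C" and above: "\<And>p. h (ray_above p) = (SUP q\<in>{q. q > p}. ?V q)"
    by blast
  have "C_le f h" if "f \<in> S" for f
    unfolding C_le_def above
  proof
    fix p :: rat
    have "(SUP q\<in>{q. q > p}. f (ray_above q)) \<le> (SUP q\<in>{q. q > p}. ?V q)"
      by (intro SUP_mono) (use upper[OF that] in blast)
    then show "f (ray_above p) \<le> (SUP q\<in>{q. q > p}. ?V q)" by (simp only: C_above[OF inC[OF that]])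
  qed
  moreover have "C_le h g" if g: "g \<in> C" "\<And>f. f \<in> S \<Longrightarrow> C_le f g" for g
    unfolding C_le_def above
  proof (intro allI SUP_least)
    fix p q :: rat assume "q \<in> {q. q > p}"
    moreover have "?V q \<le> pcomp (pcomp (g (ray_above q)))"
      using g(2) by (intro pcomp_pcomp_mono SUP_least) (simp add: C_le_def)
    ultimately show "?V q \<le> g (ray_above p)"
      using C_above_pcomp_pcomp_le[OF g(1), of p q] by simp
  qed
  ultimately show ?thesis using h by (auto simp: is_supremum_def C_riesz_def)
qed

lemma universally_complete_C:
  assumes ED: "extremally_disconnected TYPE('a::frame)" and P: "P_frame TYPE('a)"
  shows "universally_complete (C_riesz :: (ir_frame \<Rightarrow> 'a) riesz)"
  unfolding universally_complete_def
proof
  show "dedekind_complete (C_riesz :: (ir_frame \<Rightarrow> 'a) riesz)"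
    unfolding dedekind_complete_def
  proof (intro allI impI, elim conjE bexE)
    fix S :: "(ir_frame \<Rightarrow> 'a) set" and g
    assume "S \<subseteq> carrier C_riesz" "S \<noteq> {}" "g \<in> carrier C_riesz" "\<forall>f\<in>S. le C_riesz f g"
    then have S: "S \<subseteq> C" "S \<noteq> {}" and g: "g \<in> C" "\<And>f. f \<in> S \<Longrightarrow> C_le f g"
      by (simp_all add: C_riesz_def)
    have "(SUP p. pcomp (g (ray_above p))) \<le> (SUP p. pcomp (SUP f\<in>S. f (ray_above p)))"
      using g(2) by (intro SUP_mono' pcomp_antimono SUP_least) (simp add: C_le_def)
    then show "\<exists>h. is_supremum C_riesz S h"
      by (intro C_exists_supremum ED S) (simp add: C_SUP_pcomp_above[OF g(1)] top_unique)
  qed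
  show "laterally_complete (C_riesz :: (ir_frame \<Rightarrow> 'a) riesz)"
    unfolding laterally_complete_def
  proof (intro allI impI, elim conjE)
    fix S :: "(ir_frame \<Rightarrow> 'a) set"
    assume "S \<subseteq> carrier C_riesz" "S \<noteq> {}" "\<forall>f\<in>S. le C_riesz (zero C_riesz) f"
      "\<forall>f\<in>S. \<forall>g\<in>S. f \<noteq> g \<longrightarrow> meet C_riesz f g = zero C_riesz"
    then have S: "S \<subseteq> C" "S \<noteq> {}"
      and disj: "\<And>f g. f \<in> S \<Longrightarrow> g \<in> S \<Longrightarrow> f \<noteq> g \<Longrightarrow> C_meet f g = C_zero"
      by (simp_all add: C_riesz_def)
    have inC: "\<And>f. f \<in> S \<Longrightarrow> f \<in> C" using S by blast
    let ?T = "\<lambda>p. SUP f\<in>S. f (ray_above p)"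
    \<comment> \<open>The part on which the family is unbounded; once it vanishes, the bounded parts
      are dense.\<close>
    let ?e = "pcomp (SUP p. pcomp (?T p))"
    \<comment> \<open>On the support of \<open>f\<close>, disjointness leaves no other member of
      \<open>S\<close> positive.\<close>
    have T0: "inf (?T q) (f (ray_above 0)) \<le> f (ray_above q)" if f: "f \<in> S" and q: "q \<ge> 0" for f q
      unfolding SUP_inf_frame
    proof (rule SUP_least)
      fix g assume g: "g \<in> S"
      show "inf (g (ray_above q)) (f (ray_above 0)) \<le> f (ray_above q)"
      proof (cases "g = f")
        case False
        have "inf (g (ray_above q)) (f (ray_above 0)) \<le> C_meet g f (ray_above 0)"
          unfolding C_meet(2)[OF inC[OF g] inC[OF f]] by (intro inf_mono C_above_antimono inC g q order_refl)
        also have "\<dots> = bot" using disj[OF g f False] by (simp add: C_zero)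
        finally show ?thesis by (simp add: bot_unique)
      qed simp
    qed
    have "inf ?e (f (ray_above 0)) = bot" if f: "f \<in> S" for f
    proof -
      \<comment> \<open>\<open>?e\<close> lies in every regularised ray of the family, and over the
        support of \<open>f\<close> these come from \<open>f\<close> alone; finiteness of
        \<open>f\<close> then forces the meet to be bottom.\<close>
      have e: "inf ?e (f (ray_above 0)) \<le> f (ray_above p)" if p: "p \<ge> 0" for p
      proof -
        have "?e \<le> pcomp (pcomp (?T (p + 1)))" by (intro pcomp_antimono SUP_upper) simp
        then have "inf ?e (f (ray_above 0)) \<le> inf (pcomp (pcomp (?T (p + 1)))) (pcomp (pcomp (f (ray_above 0))))"
          by (intro inf_mono le_pcomp_pcomp)
        also have "\<dots> \<le> pcomp (pcomp (f (ray_above (p + 1))))"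
          unfolding pcomp_pcomp_inf[symmetric] using p by (intro pcomp_pcomp_mono T0 f) simp
        also have "\<dots> \<le> f (ray_above p)" by (intro C_above_pcomp_pcomp_le inC f) simp
        finally show ?thesis .
      qed
      have "inf ?e (f (ray_above 0)) \<le> pcomp (pcomp (f (ray_above p)))" for p
      proof (rule order_trans[OF _ le_pcomp_pcomp])
        have "f (ray_above (max p 0)) \<le> f (ray_above p)" by (simp add: C_above_antimono inC f)
        then show "inf ?e (f (ray_above 0)) \<le> f (ray_above p)" using e[of "max p 0"] by simp
      qed
      then have "inf (pcomp (f (ray_above p))) (inf ?e (f (ray_above 0))) = bot" for p
        unfolding le_pcomp_iff by simp
      then have "inf (SUP p. pcomp (f (ray_above p))) (inf ?e (f (ray_above 0))) = bot"
        unfolding SUP_inf_frame by simp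
      then show ?thesis by (simp add: C_SUP_pcomp_above[OF inC[OF f]])
    qed
    then have "inf ?e (?T 0) = bot" unfolding inf_SUP_frame by (simp cong: SUP_cong)
    \<comment> \<open>Disjoint from every support, \<open>?e\<close> lies in
      \<open>pcomp (?T 0)\<close>, yet by construction also in the double pseudocomplement.\<close>
    then have "?e \<le> pcomp (?T 0)" by (simp add: le_pcomp_iff inf_commute)
    moreover have "?e \<le> pcomp (pcomp (?T 0))" by (intro pcomp_antimono SUP_upper) simp
    ultimately have "?e \<le> inf (pcomp (?T 0)) (pcomp (pcomp (?T 0)))" by (rule inf_greatest)
    then have "?e = bot" by (simp only: inf_pcomp bot_unique)
    moreover have "complemented (SUP p. pcomp (?T p))"
      by (rule P_frame_complemented_SUP[OF P]) (rule extremally_disconnected_complemented[OF ED])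
    ultimately have "(SUP p. pcomp (?T p)) = top" by (intro complemented_dense)
    then show "\<exists>h. is_supremum C_riesz S h" by (rule C_exists_supremum[OF ED S])
  qed
qed


section \<open>The isomorphism with the Booleanization\<close>

lift_definition booleanize :: "'a::frame \<Rightarrow> 'a booleanization" is "\<lambda>a. pcomp (pcomp a)"
  by (simp add: pcomp_pcomp_pcomp)

lemma frame_hom_booleanize: "frame_hom (booleanize :: 'a::frame \<Rightarrow> _)"
  unfolding frame_hom_def
proof (intro conjI allI)
  show "booleanize top = (top :: 'a booleanization)" by transfer simp
  show "booleanize (inf a b) = inf (booleanize a) (booleanize b)" for a b :: 'a
    by transfer (rule pcomp_pcomp_inf)
  show "booleanize (Sup A) = Sup (booleanize ` A)" for A :: "'a set"
    unfolding Rep_booleanization_inject[symmetric] Sup_booleanization.rep_eq image_image booleanize.rep_eq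
    using pcomp_pcomp_SUP[of "\<lambda>a. a" A] by simp
qed

text \<open>Equal double pseudocomplements put each ray of one function under every ray of smaller
  index of the other; joining over the larger indices removes the gap.\<close>

lemma inj_on_comp_booleanize: "inj_on ((\<circ>) booleanize) (C :: (ir_frame \<Rightarrow> 'a::frame) set)"
proof (rule inj_onI)
  fix f g :: "ir_frame \<Rightarrow> 'a"
  assume f: "f \<in> C" and g: "g \<in> C" and eq: "booleanize \<circ> f = booleanize \<circ> g"
  have *: "pcomp (pcomp (f x)) = pcomp (pcomp (g x))" for x
    using arg_cong[OF fun_cong[OF eq, of x], of Rep_booleanization] by (simp add: booleanize.rep_eq)
  have le: "h (ray_above p) \<le> k (ray_above p)"
    if h: "h \<in> C" and k: "k \<in> C" and hk: "\<And>x. pcomp (pcomp (h x)) = pcomp (pcomp (k x))"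
    for h k :: "ir_frame \<Rightarrow> 'a" and p
  proof -
    have "(SUP q\<in>{q. q > p}. h (ray_above q)) \<le> k (ray_above p)"
    proof (rule SUP_least)
      fix q assume "q \<in> {q. q > p}"
      then have "pcomp (pcomp (k (ray_above q))) \<le> k (ray_above p)"
        by (intro C_above_pcomp_pcomp_le k) simp
      then show "h (ray_above q) \<le> k (ray_above p)"
        using le_pcomp_pcomp[of "h (ray_above q)"] unfolding hk by (rule order_trans[rotated])
    qed
    then show ?thesis by (simp only: C_above[OF h])
  qed
  show "f = g"
  proof (rule C_eqI[OF f g])
    show "f (ray_above p) = g (ray_above p)" for p
      using le[OF f g *, of p] le[OF g f *[symmetric], of p] by (rule antisym)
  qed
qed

text \<open>The rays of \<open>h\<close>, read in the original frame, are regular and thus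
  complemented. Their joins there may be smaller than in the Booleanization and are a priori only
  dense; the P-frame condition closes this gap.\<close>

lemma comp_booleanize_surj:
  fixes h :: "ir_frame \<Rightarrow> 'a::frame booleanization"
  assumes ED: "extremally_disconnected TYPE('a)" and P: "P_frame TYPE('a)" and h: "h \<in> C"
  shows "\<exists>f\<in>C. h = booleanize \<circ> f"
proof -
  define W where "W p = Rep_booleanization (h (ray_above p))" for p
  define Z where "Z p = Rep_booleanization (h (ray_below p))" for p
  have reg: "pcomp (pcomp (Rep_booleanization x)) = Rep_booleanization x" for x :: "'a booleanization"
    using Rep_booleanization[of x] by simp
  have compl: "complemented (W p)" for p
    using extremally_disconnected_complemented[OF ED, of "pcomp (W p)"] by (simp add: W_def reg)
  have top: "Rep_booleanization (top :: 'a booleanization) = top" by (simp add: top_booleanization.rep_eq)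
  have SUP: "pcomp (pcomp (SUP i\<in>I. Rep_booleanization (k i))) = Rep_booleanization (SUP i\<in>I. k i)"
    for k :: "rat \<Rightarrow> 'a booleanization" and I
    by (simp add: Sup_booleanization.rep_eq image_image)
  have dense_top: "a = top" if "complemented a" "pcomp (pcomp a) = top" for a :: 'a
    using that by (simp add: complemented_pcomp_pcomp)
  have mono: "W q \<le> W p" if "p \<le> q" for p q
    using C_above_antimono[OF h that] by (simp add: W_def less_eq_booleanization.rep_eq)
  have "\<exists>f\<in>C. \<forall>p. f (ray_above p) = (SUP q\<in>{q. q > p}. W q)"
  proof (rule C_exists_above)
    show "W q \<prec> W p" if "p < q" for p q
      using that by (intro complemented_rather_below compl mono) simp
    show "(SUP p. W p) = top"
    proof (rule dense_top)
      show "complemented (SUP p. W p)" by (rule P_frame_complemented_SUP[OF P compl])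
      show "pcomp (pcomp (SUP p. W p)) = top" by (simp add: W_def SUP C_SUP_above[OF h] top)
    qed
    show "(SUP p. pcomp (W p)) = top"
    proof (rule dense_top)
      show "complemented (SUP p. pcomp (W p))"
        by (intro P_frame_complemented_SUP[OF P] complemented_pcomp compl)
      have "Z p \<le> pcomp (W p)" for p
        using arg_cong[OF C_disjoint[OF h order_refl], of Rep_booleanization p]
        by (simp add: le_pcomp_iff W_def Z_def inf_booleanization.rep_eq bot_booleanization.rep_eq)
      then have "pcomp (pcomp (SUP p. Z p)) \<le> pcomp (pcomp (SUP p. pcomp (W p)))"
        by (intro pcomp_pcomp_mono SUP_mono')
      then show "pcomp (pcomp (SUP p. pcomp (W p))) = top"
        by (simp add: Z_def SUP C_SUP_below[OF h] top top_unique)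
    qed
  qed
  then obtain f where f: "f \<in> C" and above: "\<And>p. f (ray_above p) = (SUP q\<in>{q. q > p}. W q)"
    by blast
  have "Rep_booleanization (h (ray_above p)) = Rep_booleanization (booleanize (f (ray_above p)))" for p
    by (simp only: booleanize.rep_eq above W_def SUP C_above[OF h])
  then have "h = booleanize \<circ> f"
    by (intro C_eqI[OF h comp_in_C[OF frame_hom_booleanize f]]) (simp add: Rep_booleanization_inject)
  then show ?thesis using f by blast
qed

lemma riesz_iso_booleanize:
  assumes "extremally_disconnected TYPE('a::frame)" "P_frame TYPE('a)"
  shows "riesz_iso C_riesz C_riesz ((\<circ>) (booleanize :: 'a \<Rightarrow> _))"
proof (rule riesz_iso_comp[OF frame_hom_booleanize])
  have "(\<circ>) booleanize ` (C :: (ir_frame \<Rightarrow> 'a) set) = C"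
    using comp_booleanize_surj[OF assms] comp_in_C[OF frame_hom_booleanize] by blast
  then show "bij_betw ((\<circ>) booleanize) (C :: (ir_frame \<Rightarrow> 'a) set) C"
    by (simp add: bij_betw_def inj_on_comp_booleanize)
qed


section \<open>Nearly finite Hausdorff continuous functions\<close>

lemma pcomp_le_if_sup_eq_top: "sup a b = top \<Longrightarrow> pcomp a \<le> b" for a :: "'a::frame"
  by (erule le_if_sup_eq_top_inf_le) simp_all

lemma C_subset_H_nf: "C \<subseteq> H_nf"
proof
  fix f :: "ir_frame \<Rightarrow> 'a" assume f: "f \<in> C"
  then have "f \<in> IC" by (simp add: C_def)
  moreover have "pcomp (f (ray_above p)) \<le> f (ray_below q)" "pcomp (f (ray_below q)) \<le> f (ray_above p)"
    if "p < q" for p q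
    using C_cover[OF f that] by (simp_all add: pcomp_le_if_sup_eq_top sup_commute)
  moreover have "nearly_finite f" using f by (simp add: nearly_finite_def C_SUP_above C_SUP_below)
  ultimately show "f \<in> H_nf" by (simp add: H_nf_def hausdorff_continuous_def)
qed

text \<open>Each Hausdorff inequality places a regularised ray inside a neighbouring ray. Covers
  then come from extremal disconnectedness at an intermediate ray, and finiteness from near
  finiteness, as the regularised rays are complemented and countably many.\<close>

lemma H_nf_subset_C:
  assumes ED: "extremally_disconnected TYPE('a::frame)" and P: "P_frame TYPE('a)"
  shows "(H_nf :: (ir_frame \<Rightarrow> 'a) set) \<subseteq> C"
proof
  fix f :: "ir_frame \<Rightarrow> 'a" assume "f \<in> H_nf"
  then have f: "f \<in> IC" and H: "\<And>p q. p < q \<Longrightarrow> pcomp (f (ray_above p)) \<le> f (ray_below q)"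
    "\<And>p q. p < q \<Longrightarrow> pcomp (f (ray_below q)) \<le> f (ray_above p)"
    and nf: "pcomp (pcomp (SUP p. f (ray_above p))) = top" "pcomp (pcomp (SUP q. f (ray_below q))) = top"
    by (auto simp: H_nf_def hausdorff_continuous_def nearly_finite_def)
  have below_le: "f (ray_below r) \<le> pcomp (f (ray_above r))"
    and above_le: "f (ray_above r) \<le> pcomp (f (ray_below r))" for r
    using ir_hom_relations(1)[OF f, of r r] by (simp_all add: le_pcomp_iff inf_commute)
  have above: "pcomp (pcomp (f (ray_above q))) \<le> f (ray_above p)" if "p < q" for p q
    using pcomp_antimono[OF below_le[of q]] H(2)[OF that] by (rule order_trans)
  have below: "pcomp (pcomp (f (ray_below p))) \<le> f (ray_below q)" if "p < q" for p q
    using pcomp_antimono[OF above_le[of p]] H(1)[OF that] by (rule order_trans)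
  have "sup (f (ray_above p)) (f (ray_below q)) = top" if pq: "p < q" for p q
  proof (rule top_le)
    obtain r where "p < r" "r < q" using pq dense by blast
    then have "sup (pcomp (f (ray_below r))) (pcomp (pcomp (f (ray_below r)))) \<le> sup (f (ray_above p)) (f (ray_below q))"
      by (intro sup_mono H(2) below)
    then show "top \<le> sup (f (ray_above p)) (f (ray_below q))"
      using ED unfolding extremally_disconnected_def by (simp only:)
  qed
  moreover have "(SUP p. f (ray_above p)) = top"
  proof -
    have "(SUP p. pcomp (pcomp (f (ray_above p)))) \<le> (SUP p. f (ray_above p))"
    proof (rule SUP_least)
      fix p show "pcomp (pcomp (f (ray_above p))) \<le> (SUP p. f (ray_above p))"
        by (rule SUP_upper2[of "p - 1"]) (simp_all add: above)
    qed
    moreover have "complemented (SUP p. pcomp (pcomp (f (ray_above p))))"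
      by (rule P_frame_complemented_SUP[OF P]) (rule extremally_disconnected_complemented[OF ED])
    moreover have "pcomp (pcomp (SUP p. pcomp (pcomp (f (ray_above p))))) = top"
      unfolding pcomp_pcomp_SUP by (rule nf)
    ultimately show ?thesis by (simp add: complemented_pcomp_pcomp top_unique)
  qed
  moreover have "(SUP q. f (ray_below q)) = top"
  proof -
    have "(SUP p. pcomp (pcomp (f (ray_below p)))) \<le> (SUP p. f (ray_below p))"
    proof (rule SUP_least)
      fix p show "pcomp (pcomp (f (ray_below p))) \<le> (SUP p. f (ray_below p))"
        by (rule SUP_upper2[of "p + 1"]) (simp_all add: below)
    qed
    moreover have "complemented (SUP p. pcomp (pcomp (f (ray_below p))))"
      by (rule P_frame_complemented_SUP[OF P]) (rule extremally_disconnected_complemented[OF ED])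
    moreover have "pcomp (pcomp (SUP p. pcomp (pcomp (f (ray_below p))))) = top"
      unfolding pcomp_pcomp_SUP by (rule nf)
    ultimately show ?thesis by (simp add: complemented_pcomp_pcomp top_unique)
  qed
  ultimately show "f \<in> C" using f by (simp add: C_def)
qed

text \<open>The witness is \<open>1\<close> on \<open>pcomp a\<close> and \<open>0\<close> on
  \<open>pcomp (pcomp a)\<close>. It is Hausdorff continuous because these are pseudocomplements of
  each other, and the covering relation between the indices \<open>0\<close> and \<open>1\<close> is
  the claim.\<close>

lemma extremally_disconnected_if_H_nf_subset_C:
  assumes sub: "(H_nf :: (ir_frame \<Rightarrow> 'a::frame) set) \<subseteq> C"
  shows "extremally_disconnected TYPE('a)"
  unfolding extremally_disconnected_def
proof
  fix a :: 'a
  let ?u = "\<lambda>p::rat. if p < 0 then top else if p < 1 then pcomp a else bot"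
  let ?l = "\<lambda>q::rat. if q > 1 then top else if q > 0 then pcomp (pcomp a) else bot"
  have "\<exists>f\<in>IC. (\<forall>p. f (ray_above p) = ?u p) \<and> (\<forall>q. f (ray_below q) = ?l q)"
  proof (rule ir_hom_exists)
    fix p q :: rat
    show "inf (?u p) (?l q) = bot" if "p \<ge> q" using that by auto
    show "?u p = (SUP q\<in>{q. q > p}. ?u q)"
    proof (rule antisym)
      show "(SUP q\<in>{q. q > p}. ?u q) \<le> ?u p" by (rule SUP_least) auto
      show "?u p \<le> (SUP q\<in>{q. q > p}. ?u q)"
      proof -
        \<comment> \<open>The bound is the next jump of \<open>?u\<close>, or any larger index once
          no jump is left, so \<open>?u\<close> is constant up to it.\<close>
        have "p < (if p < 0 then 0 else if p < 1 then 1 else p + 1)" by simp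
        then obtain q where "p < q" "q < (if p < 0 then 0 else if p < 1 then 1 else p + 1)"
          using dense by blast
        then show ?thesis by (intro SUP_upper2[of q]) (auto split: if_splits)
      qed
    qed
    show "?l p = (SUP q\<in>{q. q < p}. ?l q)"
    proof (rule antisym)
      show "(SUP q\<in>{q. q < p}. ?l q) \<le> ?l p" by (rule SUP_least) auto
      show "?l p \<le> (SUP q\<in>{q. q < p}. ?l q)"
      proof -
        have "(if p > 1 then 1 else if p > 0 then 0 else p - 1) < p" by simp
        then obtain q where "q < p" "(if p > 1 then 1 else if p > 0 then 0 else p - 1) < q"
          using dense by blast
        then show ?thesis by (intro SUP_upper2[of q]) (auto split: if_splits)
      qed
    qed
  qed
  then obtain f where f: "f \<in> IC" and u: "\<And>p. f (ray_above p) = ?u p" and l: "\<And>q. f (ray_below q) = ?l q"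
    by blast
  have "hausdorff_continuous f"
    using f by (auto simp: hausdorff_continuous_def u l pcomp_pcomp_pcomp)
  moreover have "(SUP p. f (ray_above p)) = top"
    unfolding u by (rule top_le, rule SUP_upper2[of "-1"]) simp_all
  moreover have "(SUP q. f (ray_below q)) = top"
    unfolding l by (rule top_le, rule SUP_upper2[of 2]) simp_all
  ultimately have "f \<in> C" using sub by (auto simp: H_nf_def nearly_finite_def)
  then show "sup (pcomp a) (pcomp (pcomp a)) = top" using C_cover[of f 0 1] by (simp add: u l)
qed

text \<open>The witness takes the value \<open>n\<close> on the part of \<open>b n\<close> outside the earlier \<open>b m\<close>, and \<open>0\<close>
  on the pseudocomplement of \<open>SUP n. b n\<close>; it is finite only if these exhaust the frame.\<close>

lemma complemented_SUP_if_H_nf_subset_C: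
  fixes b :: "nat \<Rightarrow> 'a::frame"
  assumes sub: "(H_nf :: (ir_frame \<Rightarrow> 'a) set) \<subseteq> C" and b: "\<And>n. complemented (b n)"
  shows "complemented (SUP n. b n)"
proof -
  let ?a = "SUP n. b n"
  \<comment> \<open>Being above \<open>p\<close> means avoiding all \<open>b n\<close> with
    \<open>n \<le> p\<close>, being below \<open>q\<close> means lying in some \<open>b n\<close>
    with \<open>n < q\<close>; hence one weak and one strict bound.\<close>
  let ?M = "\<lambda>p. SUP n\<in>{n. of_nat n \<le> (p :: rat)}. b n"
  let ?m = "\<lambda>p. SUP n\<in>{n. of_nat n < (p :: rat)}. b n"
  let ?u = "\<lambda>p. if p < 0 then top else inf (pcomp (?M p)) (pcomp (pcomp ?a))"
  let ?l = "\<lambda>q. if q \<le> 0 then bot else sup (?m q) (pcomp ?a)"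
  note ED = extremally_disconnected_complemented[OF extremally_disconnected_if_H_nf_subset_C[OF sub]]
  have fin: "finite {n. of_nat n \<le> (p :: rat)}" for p
  proof -
    obtain N where "p \<le> of_nat N" using real_arch_simple by blast
    then have "{n. of_nat n \<le> p} \<subseteq> {..N}" by (auto dest: order_trans)
    then show ?thesis by (rule finite_subset) simp
  qed
  have M: "complemented (?M p)" for p by (rule complemented_finite_SUP[OF fin b])
  have M_mono: "?M p \<le> ?M q" if "p \<le> q" for p q
    using that by (intro SUP_subset_mono) auto
  have M_le_m: "?M p \<le> ?m q" if "p < q" for p q
    using that by (intro SUP_subset_mono) auto
  have m_le_M: "?m q \<le> ?M p" if "q \<le> p" for p q
    using that by (intro SUP_subset_mono) auto
  have "\<exists>f\<in>IC. (\<forall>p. f (ray_above p) = ?u p) \<and> (\<forall>q. f (ray_below q) = ?l q)"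
  proof (rule ir_hom_exists)
    fix p q :: rat
    show "inf (?u p) (?l q) = bot" if "p \<ge> q"
    proof (cases "q \<le> 0")
      case False
      have "inf (inf (pcomp (?M p)) (pcomp (pcomp ?a))) (sup (?m q) (pcomp ?a)) \<le> bot"
        unfolding inf_sup_distrib1
      proof (rule sup_least)
        have "inf (pcomp (?M p)) (?m q) \<le> inf (pcomp (?M p)) (?M p)"
          by (intro inf_mono order_refl m_le_M that)
        then show "inf (inf (pcomp (?M p)) (pcomp (pcomp ?a))) (?m q) \<le> bot"
          unfolding inf_pcomp by (rule order_trans[rotated]) (simp add: le_infI1)
        show "inf (inf (pcomp (?M p)) (pcomp (pcomp ?a))) (pcomp ?a) \<le> bot"
          by (simp add: inf_assoc)
      qed
      then show ?thesis using False that by (simp add: bot_unique)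
    qed simp
    show "?u p = (SUP q\<in>{q. q > p}. ?u q)"
    proof (rule antisym)
      show "(SUP q\<in>{q. q > p}. ?u q) \<le> ?u p"
        by (intro SUP_least) (auto intro!: le_infI1 pcomp_antimono M_mono)
      \<comment> \<open>No integer lies strictly between \<open>p\<close> and
        \<open>floor p + 1\<close>, so \<open>?M\<close> is constant there.\<close>
      have "p < of_int (floor p) + 1" by linarith
      then obtain q where q: "p < q" "q < of_int (floor p) + 1"
        using dense by blast
      have "of_nat n \<le> p" if "of_nat n \<le> q" for n
      proof -
        have "of_int (int n) < (of_int (floor p + 1) :: rat)" using that q by simp
        then have "int n \<le> floor p" by (simp only: of_int_less_iff)
        then show ?thesis by (simp add: le_floor_iff)
      qed
      then have "?M q \<le> ?M p" by (intro SUP_subset_mono) auto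
      moreover have "q < 0" if "p < 0"
      proof -
        have "floor p + 1 \<le> 0" using that by linarith
        then have "of_int (floor p + 1) \<le> (0 :: rat)" by (simp only: of_int_le_0_iff)
        then show ?thesis using q by simp
      qed
      ultimately have "?u p \<le> ?u q" using q(1) by (auto intro: pcomp_antimono le_infI1)
      then show "?u p \<le> (SUP q\<in>{q. q > p}. ?u q)" using q(1) by (intro SUP_upper2[of q]) simp_all
    qed
    show "?l p = (SUP q\<in>{q. q < p}. ?l q)"
    proof (rule antisym)
      show "(SUP q\<in>{q. q < p}. ?l q) \<le> ?l p"
        by (intro SUP_least) (auto intro!: le_supI1 SUP_subset_mono)
      have "of_int (ceiling p) - 1 < p" by linarith
      then obtain q where q: "q < p" "of_int (ceiling p) - 1 < q"
        using dense by blast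
      have "of_nat n < q" if "of_nat n < p" for n
      proof -
        have "int n < ceiling p" using that by (simp add: less_ceiling_iff)
        then have "int n \<le> ceiling p - 1" by simp
        then have "of_int (int n) \<le> (of_int (ceiling p - 1) :: rat)" by (simp only: of_int_le_iff)
        then show ?thesis using q by simp
      qed
      then have "?m p \<le> ?m q" and "0 < p \<Longrightarrow> 0 < q"
        by (auto intro!: SUP_subset_mono) (metis of_nat_0)
      then have "?l p \<le> ?l q" by (auto intro: le_supI1)
      then show "?l p \<le> (SUP q\<in>{q. q < p}. ?l q)" using q(1) by (intro SUP_upper2[of q]) simp_all
    qed
  qed
  then obtain f where f: "f \<in> IC" and u: "\<And>p. f (ray_above p) = ?u p" and l: "\<And>q. f (ray_below q) = ?l q"
    by blast
  have "hausdorff_continuous f"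
    unfolding hausdorff_continuous_def
  proof (intro conjI allI impI f)
    fix p q :: rat assume pq: "p < q"
    show "pcomp (f (ray_above p)) \<le> f (ray_below q)"
    proof (cases "p < 0")
      case False
      \<comment> \<open>Extremal disconnectedness, already available, lets the pseudocomplement of
        the meet split into a join.\<close>
      have "pcomp (f (ray_above p)) = sup (?M p) (pcomp ?a)"
        unfolding u using False
        by (simp add: pcomp_inf_complemented[OF complemented_pcomp[OF M] ED] complemented_pcomp_pcomp[OF M] pcomp_pcomp_pcomp)
      also have "\<dots> \<le> f (ray_below q)" using False pq M_le_m[OF pq] by (simp add: l le_supI1)
      finally show ?thesis .
    qed (simp add: u)
    show "pcomp (f (ray_below q)) \<le> f (ray_above p)"
    proof (cases "p < 0")
      case False
      then have "pcomp (f (ray_below q)) = inf (pcomp (?m q)) (pcomp (pcomp ?a))"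
        using pq by (simp add: l pcomp_sup)
      also have "\<dots> \<le> f (ray_above p)"
        using False pcomp_antimono[OF M_le_m[OF pq]] by (simp add: u le_infI1)
      finally show ?thesis .
    qed (simp add: u)
  qed
  moreover have "(SUP p. f (ray_above p)) = top"
    unfolding u by (rule top_le, rule SUP_upper2[of "-1"]) simp_all
  \<comment> \<open>The relation that carries the information: the lower rays join to a dense
    element, which is top exactly when \<open>?a\<close> is complemented.\<close>
  moreover have l_eq: "(SUP q. f (ray_below q)) = sup ?a (pcomp ?a)"
  proof (rule antisym)
    show "(SUP q. f (ray_below q)) \<le> sup ?a (pcomp ?a)"
      unfolding l by (intro SUP_least) (auto intro!: le_supI1 SUP_subset_mono)
    have "b n \<le> (SUP q. f (ray_below q))" for n
      by (rule SUP_upper2[of "of_nat (Suc n)"]) (auto simp: l intro!: le_supI1 SUP_upper)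
    moreover have "pcomp ?a \<le> (SUP q. f (ray_below q))"
      by (rule SUP_upper2[of 1]) (simp_all add: l)
    ultimately show "sup ?a (pcomp ?a) \<le> (SUP q. f (ray_below q))"
      by (intro sup_least SUP_least)
  qed
  moreover have "pcomp (pcomp (sup ?a (pcomp ?a))) = top" by (simp add: pcomp_sup)
  ultimately have "f \<in> C" using sub by (auto simp: H_nf_def nearly_finite_def)
  then have "(SUP q. f (ray_below q)) = top" by (rule C_SUP_below)
  then show ?thesis by (simp add: l_eq complemented_def)
qed

lemma C_eq_H_nf_iff:
  "(C :: (ir_frame \<Rightarrow> 'a::frame) set) = H_nf \<longleftrightarrow> extremally_disconnected TYPE('a) \<and> P_frame TYPE('a)"
proof
  assume eq: "(C :: (ir_frame \<Rightarrow> 'a) set) = H_nf"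
  then have sub: "(H_nf :: (ir_frame \<Rightarrow> 'a) set) \<subseteq> C" by simp
  note ED = extremally_disconnected_if_H_nf_subset_C[OF sub]
  then have "P_frame TYPE('a)"
    unfolding P_frame_def using cozero_eq_SUP_complemented[OF ED] complemented_SUP_if_H_nf_subset_C[OF sub] by blast
  with ED show "extremally_disconnected TYPE('a) \<and> P_frame TYPE('a)" ..
next
  assume "extremally_disconnected TYPE('a) \<and> P_frame TYPE('a)"
  then show "(C :: (ir_frame \<Rightarrow> 'a) set) = H_nf" using C_subset_H_nf H_nf_subset_C by blast
qed


section \<open>Universal completeness\<close>

text \<open>The interpolating elements increase with their index whereas upper rays decrease, hence
  the reversal \<open>c (1 - p)\<close>.\<close>

lemma completely_below_urysohn:
  fixes a b :: "'a::frame"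
  assumes "b \<prec>\<prec> a"
  shows "\<exists>f\<in>C. (\<forall>p<0. f (ray_above p) = top) \<and> (\<forall>p\<ge>0. f (ray_above p) \<le> a)
    \<and> (\<forall>p<1. b \<le> f (ray_above p)) \<and> (\<forall>p\<ge>1. f (ray_above p) = bot)"
proof -
  obtain c :: "rat \<Rightarrow> 'a" where c0: "b \<le> c 0" and c1: "c 1 \<le> a"
    and c: "\<And>r s. r \<in> {0..1} \<Longrightarrow> s \<in> {0..1} \<Longrightarrow> r < s \<Longrightarrow> c r \<prec> c s"
    using assms by (auto simp: completely_below_def)
  let ?V = "\<lambda>p. if p < 0 then top else if p \<le> 1 then c (1 - p) else bot"
  have "\<exists>f\<in>C. \<forall>p. f (ray_above p) = (SUP q\<in>{q. q > p}. ?V q)"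
  proof (rule C_exists_above)
    show "?V q \<prec> ?V p" if "p < q" for p q using that c by auto
    show "(SUP p. ?V p) = top" by (rule top_le, rule SUP_upper2[of "-1"]) simp_all
    show "(SUP p. pcomp (?V p)) = top" by (rule top_le, rule SUP_upper2[of 2]) simp_all
  qed
  then obtain f where f: "f \<in> C" and above: "\<And>p. f (ray_above p) = (SUP q\<in>{q. q > p}. ?V q)"
    by blast
  have "f (ray_above p) = top" if p: "p < 0" for p
  proof -
    obtain q where "p < q" "q < 0" using p dense by blast
    then show ?thesis unfolding above by (intro top_le SUP_upper2[of q]) simp_all
  qed
  moreover have "f (ray_above p) \<le> a" if p: "p \<ge> 0" for p
    unfolding above
  proof (rule SUP_least)
    fix q assume "q \<in> {q. q > p}"
    then have q: "q > 0" using p by simp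
    show "?V q \<le> a"
    proof (cases "q \<le> 1")
      case True
      then have "c (1 - q) \<le> c 1" using q by (intro rather_below_le c) auto
      then show ?thesis using True q c1 by simp
    qed (use q in simp)
  qed
  moreover have "b \<le> f (ray_above p)" if "p < 1" for p
    unfolding above by (rule SUP_upper2[of 1]) (use that c0 in simp_all)
  moreover have "f (ray_above p) = bot" if "p \<ge> 1" for p
    unfolding above by (intro bot_unique[THEN iffD1] SUP_least) (use that in auto)
  ultimately show ?thesis using f by blast
qed

text \<open>If \<open>h\<close> is the supremum of the functions with values in \<open>[0, 1]\<close> that are supported in \<open>a\<close>,
  then \<open>a \<le> h(1/2, -) \<prec> h(0, -) \<le> a\<^sup>*\<^sup>*\<close>.\<close>

lemma dedekind_complete_imp_extremally_disconnected:
  assumes reg: "completely_regular TYPE('a::frame)"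
    and complete: "dedekind_complete (C_riesz :: (ir_frame \<Rightarrow> 'a) riesz)"
  shows "extremally_disconnected TYPE('a)"
  unfolding extremally_disconnected_def
proof
  fix a :: 'a
  have regular: "x = Sup {b. b \<prec>\<prec> x}" for x :: 'a
    using reg by (simp add: completely_regular_def)
  define S where "S = {f \<in> C. (\<forall>p\<ge>0. f (ray_above p) \<le> a) \<and> (\<forall>p\<ge>1. f (ray_above p) = bot)}"
  have S: "S \<subseteq> C" by (auto simp: S_def)
  have "C_zero \<in> S" by (simp add: S_def C_zero)
  \<comment> \<open>The constant function \<open>1\<close>, an upper bound of
    \<open>S\<close>.\<close>
  obtain g :: "ir_frame \<Rightarrow> 'a" where g: "g \<in> C"
    "\<And>p. g (ray_above p) = (if p < 0 then top else if p < 1 then top else bot)"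
    using C_exists_indicator[OF complementedI[of top bot], of 1] by auto
  have "\<forall>f\<in>S. C_le f g" by (auto simp: S_def C_le_def g)
  then have "\<exists>h. is_supremum C_riesz S h"
    using complete S \<open>C_zero \<in> S\<close> g(1) unfolding dedekind_complete_def by (auto simp: C_riesz_def)
  then obtain h where h: "h \<in> C" and upper: "\<And>f. f \<in> S \<Longrightarrow> C_le f h"
    and least: "\<And>g. g \<in> C \<Longrightarrow> (\<And>f. f \<in> S \<Longrightarrow> C_le f g) \<Longrightarrow> C_le h g"
    by (auto simp: is_supremum_def C_riesz_def)
  \<comment> \<open>Any index strictly between \<open>0\<close> and \<open>1\<close> would serve;
    its distance from \<open>0\<close> is what finally yields \<open>\<prec>\<close>.\<close>
  have "b \<le> h (ray_above (1 / 2))" if b: "b \<prec>\<prec> a" for b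
  proof -
    obtain f where "f \<in> S" "b \<le> f (ray_above (1 / 2))"
      using completely_below_urysohn[OF b] by (auto simp: S_def)
    then show ?thesis using upper[of f] order_trans unfolding C_le_def by blast
  qed
  then have a_le: "a \<le> h (ray_above (1 / 2))"
    by (subst regular) (auto intro: Sup_least)
  have "d \<le> pcomp (h (ray_above 0))" if d: "d \<prec>\<prec> pcomp a" for d
  proof -
    obtain k where k: "k \<in> C" "\<And>p. p < 0 \<Longrightarrow> k (ray_above p) = top"
      "\<And>p. p \<ge> 0 \<Longrightarrow> k (ray_above p) \<le> pcomp a" "\<And>p. p < 1 \<Longrightarrow> d \<le> k (ray_above p)"
      "\<And>p. p \<ge> 1 \<Longrightarrow> k (ray_above p) = bot"
      using completely_below_urysohn[OF d] by blast
    obtain m where m: "m \<in> C" "\<And>p. m (ray_above p) = k (ray_below (1 - p))"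
      using C_exists_reflect[OF k(1), of 1] by blast
    have "C_le f m" if f: "f \<in> S" for f
      unfolding C_le_def
    proof
      fix p
      have pcomp_le: "pcomp (k (ray_above q)) \<le> m (ray_above p)" if "q < 1 - p" for q
        unfolding m C_below_eq[OF k(1)] using that by (intro SUP_upper) simp
      consider "p < 0" | "0 \<le> p" "p < 1" | "p \<ge> 1" by linarith
      then show "f (ray_above p) \<le> m (ray_above p)"
      proof cases
        case 1
        then show ?thesis using pcomp_le[of 1] by (simp add: k(5) top_unique)
      next
        case 2
        have "f (ray_above p) \<le> a" using f 2 by (simp add: S_def)
        also have "a \<le> pcomp (k (ray_above 0))"
          using order_trans[OF le_pcomp_pcomp pcomp_antimono[OF k(3)[OF order_refl]]] .
        also have "\<dots> \<le> m (ray_above p)" using 2 by (intro pcomp_le) simp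
        finally show ?thesis .
      next
        case 3
        then show ?thesis using f by (simp add: S_def)
      qed
    qed
    then have "h (ray_above 0) \<le> m (ray_above 0)" using least[OF m(1)] by (simp add: C_le_def)
    also have "\<dots> \<le> pcomp d"
      unfolding m C_below_eq[OF k(1)] by (intro SUP_least pcomp_antimono k(4)) simp
    finally show ?thesis by (simp add: le_pcomp_iff inf_commute)
  qed
  then have "pcomp a \<le> pcomp (h (ray_above 0))"
    by (subst regular[of "pcomp a"]) (auto intro: Sup_least)
  then have "h (ray_above 0) \<le> pcomp (pcomp a)" by (simp add: le_pcomp_iff inf_commute)
  then have "a \<prec> pcomp (pcomp a)"
    using a_le by (intro rather_below_mono[OF C_above_rather_below[OF h, of 0 "1 / 2"]]) simp_all
  then show "sup (pcomp a) (pcomp (pcomp a)) = top" by (simp add: rather_below_def)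
qed

text \<open>Disjointify the \<open>b n\<close> into \<open>d n\<close>.  An upper bound of the functions with value \<open>n\<close> on \<open>d n\<close>
  is finite, hence locally meets only finitely many \<open>d n\<close>.\<close>

lemma laterally_complete_imp_complemented_SUP:
  fixes b :: "nat \<Rightarrow> 'a::frame"
  assumes complete: "laterally_complete (C_riesz :: (ir_frame \<Rightarrow> 'a) riesz)"
    and b: "\<And>n. complemented (b n)"
  shows "complemented (SUP n. b n)"
proof -
  define B where "B n = (SUP m\<in>{..<n}. b m)" for n
  define d where "d n = inf (b n) (pcomp (B n))" for n
  have B: "complemented (B n)" for n unfolding B_def by (intro complemented_finite_SUP b) simp
  have d: "complemented (d n)" for n unfolding d_def by (intro complemented_inf complemented_pcomp b B)
  have disj: "inf (d m) (d n) = bot" if "m \<noteq> n" for m n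
  proof -
    have less: "inf (d m) (d n) \<le> bot" if "m < n" for m n
    proof -
      have "b m \<le> B n" unfolding B_def using that by (intro SUP_upper) simp
      then have "inf (d m) (d n) \<le> inf (B n) (pcomp (B n))"
        unfolding d_def by (intro inf_mono) (simp_all add: le_infI1)
      then show ?thesis by simp
    qed
    show ?thesis using that less[of m n] less[of n m] by (metis bot_unique inf_commute linorder_neqE_nat)
  qed
  have "\<exists>f. f \<in> C \<and> (\<forall>p. f (ray_above p) = (if p < 0 then top else if p < of_nat n then d n else bot))" for n
    using C_exists_indicator[OF d, of "of_nat n" n] unfolding Bex_def by simp
  then obtain f where f: "\<And>n. f n \<in> C"
    and above: "\<And>n p. f n (ray_above p) = (if p < 0 then top else if p < of_nat n then d n else bot)"
    by metis
  have "C_le C_zero (f n)" for n by (simp add: C_le_def C_zero above)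
  \<comment> \<open>Distinctness is that of functions: those attached to empty pieces all coincide
    with zero.\<close>
  moreover have "C_meet (f m) (f n) = C_zero" if "f m \<noteq> f n" for m n
  proof (rule C_meet_eqI[OF C_zero(1)])
    have "m \<noteq> n" using that by auto
    then show "C_zero (ray_above p) = inf (f m (ray_above p)) (f n (ray_above p))" for p
      using disj by (simp add: C_zero(2) above)
  qed
  moreover have "range f \<subseteq> C" using f by auto
  ultimately have "\<exists>h. is_supremum C_riesz (range f) h"
    using complete unfolding laterally_complete_def by (simp add: C_riesz_def)
  then obtain h where h: "h \<in> C" and upper: "\<And>n. C_le (f n) h"
    by (auto simp: is_supremum_def C_riesz_def)
  let ?a = "SUP n. b n"
  have "pcomp (h (ray_above p)) \<le> sup ?a (pcomp ?a)" for p
  proof -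
    let ?e = "pcomp (h (ray_above p))"
    obtain M where M: "max p 0 < of_nat M" using reals_Archimedean2 by blast
    \<comment> \<open>Where \<open>h\<close> does not exceed \<open>p\<close>, no piece of height
      above \<open>p\<close> can be present.\<close>
    have ed: "inf ?e (d n) = bot" if "n \<ge> M" for n
    proof -
      have "max p 0 < of_nat n" by (rule less_le_trans[OF M]) (use that in simp)
      then have "d n \<le> f n (ray_above p)" by (simp add: above)
      also have "\<dots> \<le> h (ray_above p)" using upper[of n] by (simp add: C_le_def)
      finally have "inf ?e (d n) \<le> inf ?e (h (ray_above p))" by (intro inf_mono order_refl)
      then show ?thesis by (simp add: bot_unique)
    qed
    \<comment> \<open>From \<open>M\<close> on, a new \<open>b n\<close> adds to \<open>B n\<close>
      only the piece \<open>d n\<close>, which \<open>?e\<close> misses.\<close>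
    have eB: "inf ?e (B n) \<le> B M" if "n \<ge> M" for n
      using that
    proof (induction n rule: dec_induct)
      case (step n)
      have Suc: "B (Suc n) = sup (b n) (B n)" by (simp add: B_def lessThan_Suc)
      have "inf ?e (b n) \<le> B M"
      proof (rule le_if_sup_eq_top_inf_le)
        show "sup (B n) (pcomp (B n)) = top" using B by (simp add: complemented_def)
        show "inf (inf ?e (b n)) (B n) \<le> B M"
          using step.IH by (rule order_trans[rotated]) (simp add: le_infI1 le_infI2)
        have "inf (inf ?e (b n)) (pcomp (B n)) = inf ?e (d n)" by (simp only: d_def inf_assoc)
        then show "inf (inf ?e (b n)) (pcomp (B n)) \<le> B M" using ed[OF step.hyps(1)] by simp
      qed
      then show ?case unfolding Suc inf_sup_distrib1 using step.IH by (rule sup_least)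
    qed simp
    have "inf ?e (b n) \<le> B M" for n
    proof -
      have "b n \<le> B (max M (Suc n))" unfolding B_def by (intro SUP_upper) simp
      then have "inf ?e (b n) \<le> inf ?e (B (max M (Suc n)))" by (intro inf_mono order_refl)
      also have "\<dots> \<le> B M" by (rule eB) simp
      finally show ?thesis .
    qed
    then have ea: "inf ?e ?a \<le> B M" unfolding inf_SUP_frame by (rule SUP_least)
    \<comment> \<open>Split \<open>?e\<close> along \<open>B M\<close>: inside it is below
      \<open>?a\<close>, outside it is disjoint from \<open>?a\<close>.\<close>
    show ?thesis
    proof (rule le_if_sup_eq_top_inf_le)
      show "sup (B M) (pcomp (B M)) = top" using B by (simp add: complemented_def)
      have "B M \<le> ?a" unfolding B_def by (intro SUP_subset_mono) simp_all
      then show "inf ?e (B M) \<le> sup ?a (pcomp ?a)" by (simp add: le_infI2 le_supI1)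
      have "inf (inf ?e ?a) (pcomp (B M)) \<le> inf (B M) (pcomp (B M))" by (intro inf_mono ea order_refl)
      then have "inf ?a (inf ?e (pcomp (B M))) = bot"
        by (simp only: inf_pcomp bot_unique inf_assoc inf_left_commute)
      then show "inf ?e (pcomp (B M)) \<le> sup ?a (pcomp ?a)" by (intro le_supI2) (simp add: le_pcomp_iff)
    qed
  qed
  then have "(SUP p. pcomp (h (ray_above p))) \<le> sup ?a (pcomp ?a)" by (rule SUP_least)
  then show ?thesis by (simp add: C_SUP_pcomp_above[OF h] complemented_def top_unique)
qed

lemma universally_complete_imp_extremally_disconnected_P_frame:
  assumes "completely_regular TYPE('a::frame)" "universally_complete (C_riesz :: (ir_frame \<Rightarrow> 'a) riesz)"
  shows "extremally_disconnected TYPE('a) \<and> P_frame TYPE('a)"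
proof -
  have ED: "extremally_disconnected TYPE('a)"
    using assms dedekind_complete_imp_extremally_disconnected unfolding universally_complete_def by blast
  moreover have "P_frame TYPE('a)"
    unfolding P_frame_def
    using assms(2) cozero_eq_SUP_complemented[OF ED] laterally_complete_imp_complemented_SUP
    unfolding universally_complete_def by blast
  ultimately show ?thesis ..
qed

theorem proposition5p1:
  assumes "completely_regular TYPE('a::frame)"
  shows "(extremally_disconnected TYPE('a) \<and> P_frame TYPE('a)
            \<longleftrightarrow> (C :: (ir_frame \<Rightarrow> 'a) set) = H_nf)
       \<and> ((C :: (ir_frame \<Rightarrow> 'a) set) = H_nf
            \<longleftrightarrow> riesz_isomorphic (C_riesz :: (ir_frame \<Rightarrow> 'a) riesz)
                  (C_riesz :: (ir_frame \<Rightarrow> 'a booleanization) riesz))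
       \<and> (riesz_isomorphic (C_riesz :: (ir_frame \<Rightarrow> 'a) riesz)
              (C_riesz :: (ir_frame \<Rightarrow> 'a booleanization) riesz)
            \<longleftrightarrow> universally_complete (C_riesz :: (ir_frame \<Rightarrow> 'a) riesz))"
    (is "(?P \<longleftrightarrow> ?H) \<and> (?H \<longleftrightarrow> ?I) \<and> (?I \<longleftrightarrow> ?U)")
proof -
  have "?P \<longleftrightarrow> ?H" using C_eq_H_nf_iff by blast
  moreover have "?P \<Longrightarrow> ?I" using riesz_iso_booleanize unfolding riesz_isomorphic_def by blast
  \<comment> \<open>The isomorphism given here is arbitrary and need not be induced by
    \<open>booleanize\<close>; it transports completeness through meets and scalar
    multiples.\<close>
  moreover have "?I \<Longrightarrow> ?U"
    using universally_complete_riesz_iso universally_complete_C[OF booleanization_P_frame]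
    unfolding riesz_isomorphic_def by blast
  moreover have "?U \<Longrightarrow> ?P"
    using universally_complete_imp_extremally_disconnected_P_frame[OF assms] by blast
  ultimately show ?thesis by blast
qed

end
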